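(* Let $k$ be a field of characteristic zero, $X$ an irreducible quasi-projective $k$-variety, and $A=k[x]/(x^m)$ with $m\ge 2$. On the reduced additive higher Chow complex $\mathcal{Z}_*(X,*;A)_0$, the boundary map $\partial'=\partial^0_{\rm last}$ and the Connes operator $\delta$ satisfy $$\partial'\delta=\delta\partial'.$$ That is, for all integers $p\ge 1$, $n\ge 1$ the two composites $\mathcal{Z}_p(X,n;A)_0\to \mathcal{Z}_{p-1}(X,n;A)_0$ agree.
   Context: Let $\square=\mathbb{P}^1\setminus\{1\}$. For $A=k[x]/(x^m)$ put $\Diamond_n(A)=\mathbb{A}^1\times\square^n$ with coordinates $(x,t_1,\dots,t_n)$, and $\widehat{\Diamond}_n(A)=\mathbb{A}^1\times(\mathbb{P}^1)^n$. The codimension one faces of $X\times\Diamond_n(A)$ are $F_i^j=\{t_i=j\}$ ($1\le i\le n$, $j\in\{0,\infty\}$) and the degenerate face $V_0=\{x=0\}$; higher codimension faces are obtained by intersecting these. Additive cycles. Let $c_0(X,n;A)$ be the free abelian group on the closed points of $X\times\Diamond_n(A)$ not lying on any face. For $p\ge1$ let $c_p(X,n;A)$ be the free abelian group on the $p$-dimensional irreducible closed subvarieties $Z\subset X\times\Diamond_n(A)$ such that, with $\widehat Z$ the Zariski closure of $Z$ in $X\times\widehat\Diamond_n(A)$ and $\nu:\overline Z\to\widehat Z$ its normalization: (1) $\widehat Z$ intersects all faces properly; (2) (modulus condition) for each closed point $\mathfrak p\in\nu^*V_0$ there is an $i\in\{1,\dots,n\}$ with $1-t_i\in (x^m)\cdot\mathcal{O}_{\overline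 Z,\mathfrak p}$. Let $\mathcal{Z}_p(X,n;A)$ (also written $\mathcal{Z}_p(X\times\Diamond_n(A))$) be $c_p(X,n;A)$ modulo degenerate cycles, i.e. those pulled back from $X\times\Diamond_{n-1}(A)$ along the projections forgetting one $t_i$. Let $\partial_i^j:\mathcal{Z}_p(X,n;A)\to\mathcal{Z}_{p-1}(X,n-1;A)$ be the intersection product with $F_i^j$, and $\partial=\sum_{i=1}^n(-1)^i(\partial_i^0-\partial_i^\infty)$. Reduced complex. $\mathcal{Z}_p(X,n;A)_0:=\bigcap_{i=1}^{n-1}\left(\ker\partial_i^0\cap\ker\partial_i^\infty\right)\cap\ker\partial_n^\infty$, with boundary $\partial':=\partial_n^0=\partial^0_{\rm last}$ on $\mathcal{Z}_p(X,n;A)_0$. Connes operator. For $1\le l\le n+1$ the rational map $(x,t_1,\dots,t_n)\mapsto(x,t_1,\dots,t_{l-1},\tfrac1x,t_l,\dots,t_n)$ from $\mathbb{A}^1\times\square^n$ to $\mathbb{A}^1\times\square^{n+1}$ (identity on $X$) induces, by taking (closures of) images of cycles, a homomorphism $\delta_l:\mathcal{Z}_p(X,n;A)\to\mathcal{Z}_p(X,n+1;A)$ (points where $1/x=1$ lie outside $\square$ and are discarded). Put $\delta=\sum_{l=1}^{n+1}(-1)^l\delta_l$; it maps $\mathcal{Z}_p(X,n;A)_0$ into $\mathcal{Z}_p(X,n+1;A)_0$. *)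

theory Defs
  imports "HOL-Algebra.Algebra" "HOL-Algebra.Algebraic_Closure_Type"
    "HOL-Analysis.Abstract_Topology" "HOL-Library.Extended_Nat"
begin

text \<open>
  Conventions. The base field \<open>k\<close> is the whole type \<open>'k\<close>. Reduced \<open>k\<close>-schemes of finite type are
  handled through their points over the algebraic closure \<open>K\<close> = \<^typ>\<open>'k alg_closure\<close>, with the
  \<open>k\<close>-Zariski topology, whose closed sets are the zero sets of polynomials with coefficients in
  \<open>k\<close>. Reduced (integral) closed subschemes over \<open>k\<close> then correspond to closed (irreducible closed)
  subsets, a closed point being a Galois orbit, i.e. a closed irreducible set of dimension 0.
\<close>

section \<open>Multigraded forms and the Zariski topology\<close>

text \<open>
  \<open>mform G d F\<close>: \<open>F\<close> is the function given by a multihomogeneous polynomial over \<open>k\<close> of multidegree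
  \<open>d\<close> in the coordinate functions listed, with their degrees, in \<open>G\<close>.
\<close>

inductive mform ::
  "((nat \<Rightarrow> nat) \<times> ('p \<Rightarrow> 'k::field alg_closure)) set \<Rightarrow> (nat \<Rightarrow> nat) \<Rightarrow> ('p \<Rightarrow> 'k alg_closure) \<Rightarrow> bool"
  for G where
  const: "mform G (\<lambda>_. 0) (\<lambda>_. to_ac c)"
| coord: "(d, f) \<in> G \<Longrightarrow> mform G d f"
| add: "mform G d F \<Longrightarrow> mform G d F' \<Longrightarrow> mform G d (\<lambda>P. F P + F' P)"
| mult: "mform G d F \<Longrightarrow> mform G e F' \<Longrightarrow> mform G (\<lambda>i. d i + e i) (\<lambda>P. F P * F' P)"

definition zariski ::
  "'p set \<Rightarrow> ((nat \<Rightarrow> nat) \<times> ('p \<Rightarrow> 'k::field alg_closure)) set \<Rightarrow> 'p topology" where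
  "zariski S G = topology_generated_by {{P \<in> S. F P \<noteq> 0} | F. \<exists>d. mform G d F}"

definition irreducible_in :: "'p topology \<Rightarrow> 'p set \<Rightarrow> bool" where
  "irreducible_in T S \<longleftrightarrow> S \<subseteq> topspace T \<and> S \<noteq> {} \<and>
     (\<forall>A B. closedin T A \<and> closedin T B \<and> S \<subseteq> A \<union> B \<longrightarrow> S \<subseteq> A \<or> S \<subseteq> B)"

definition irr_components :: "'p topology \<Rightarrow> 'p set \<Rightarrow> 'p set set" where
  "irr_components T S = {W. irreducible_in T W \<and> W \<subseteq> S \<and>
     (\<forall>V. irreducible_in T V \<and> W \<subseteq> V \<and> V \<subseteq> S \<longrightarrow> V = W)}"

definition krull_dim :: "'p topology \<Rightarrow> 'p set \<Rightarrow> enat" where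
  "krull_dim T S = Sup {enat l | l. \<exists>c :: nat \<Rightarrow> 'p set.
     (\<forall>i\<le>l. closedin (subtopology T S) (c i) \<and> irreducible_in T (c i)) \<and>
     (\<forall>i<l. c i \<subset> c (Suc i))}"

section \<open>Function fields and local rings\<close>

text \<open>
  Rational functions on an irreducible \<open>Z\<close> are quotients of forms of equal multidegree, the
  denominator not vanishing identically on \<open>Z\<close>, up to equality on \<open>Z\<close>.
\<close>

definition fracs ::
  "((nat \<Rightarrow> nat) \<times> ('p \<Rightarrow> 'k::field alg_closure)) set \<Rightarrow> 'p set \<Rightarrow>
   (('p \<Rightarrow> 'k alg_closure) \<times> ('p \<Rightarrow> 'k alg_closure)) set" where
  "fracs G Z = {(F, H). (\<exists>d. mform G d F \<and> mform G d H) \<and> (\<exists>P\<in>Z. H P \<noteq> 0)}"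

definition frac_rel where
  "frac_rel G Z = {((F, H), (F', H')). (F, H) \<in> fracs G Z \<and> (F', H') \<in> fracs G Z \<and>
     (\<forall>P\<in>Z. F P * H' P = F' P * H P)}"

definition ratio ::
  "((nat \<Rightarrow> nat) \<times> ('p \<Rightarrow> 'k::field alg_closure)) set \<Rightarrow> 'p set \<Rightarrow>
   ('p \<Rightarrow> 'k alg_closure) \<Rightarrow> ('p \<Rightarrow> 'k alg_closure) \<Rightarrow>
   (('p \<Rightarrow> 'k alg_closure) \<times> ('p \<Rightarrow> 'k alg_closure)) set" where
  "ratio G Z F H = frac_rel G Z `` {(F, H)}"

definition function_field ::
  "((nat \<Rightarrow> nat) \<times> ('p \<Rightarrow> 'k::field alg_closure)) set \<Rightarrow> 'p set \<Rightarrow>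
   (('p \<Rightarrow> 'k alg_closure) \<times> ('p \<Rightarrow> 'k alg_closure)) set ring" where
  "function_field G Z =
    \<lparr>carrier = fracs G Z // frac_rel G Z,
     monoid.mult = (\<lambda>a b. \<Union>(F, H)\<in>a. \<Union>(F', H')\<in>b.
       ratio G Z (\<lambda>P. F P * F' P) (\<lambda>P. H P * H' P)),
     monoid.one = ratio G Z (\<lambda>_. 1) (\<lambda>_. 1),
     ring.zero = ratio G Z (\<lambda>_. 0) (\<lambda>_. 1),
     add = (\<lambda>a b. \<Union>(F, H)\<in>a. \<Union>(F', H')\<in>b.
       ratio G Z (\<lambda>P. F P * H' P + F' P * H P) (\<lambda>P. H P * H' P))\<rparr>"

text \<open>The local ring \<open>\<O>\<^bsub>Z,W\<^esub>\<close> for an irreducible \<open>W \<subseteq> Z\<close>, as a subset of the function field;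
  for \<open>W = {P}\<close> it is the local ring at the closed point underlying \<open>P\<close>.\<close>

definition local_ring where
  "local_ring G Z W = {ratio G Z F H | F H. (F, H) \<in> fracs G Z \<and> (\<exists>P\<in>W. H P \<noteq> 0)}"

text \<open>The length of \<open>R/I\<close>: the maximal length of a chain of ideals between \<open>I\<close> and \<open>R\<close>.\<close>

definition quot_length :: "('a, 'b) ring_scheme \<Rightarrow> 'a set \<Rightarrow> nat" where
  "quot_length R I = Sup {l. \<exists>J :: nat \<Rightarrow> 'a set.
     (\<forall>i\<le>l. ideal (J i) R \<and> I \<subseteq> J i) \<and> (\<forall>i<l. J i \<subset> J (Suc i))}"

definition integral_closure :: "('a, 'b) ring_scheme \<Rightarrow> 'a set \<Rightarrow> 'a set" where
  "integral_closure R A = {a \<in> carrier R. \<exists>q \<in> carrier (univ_poly R A).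
     q \<noteq> [] \<and> hd q = \<one>\<^bsub>R\<^esub> \<and> ring.eval R q a = \<zero>\<^bsub>R\<^esub>}"

definition localization :: "('a, 'b) ring_scheme \<Rightarrow> 'a set \<Rightarrow> 'a set \<Rightarrow> 'a set" where
  "localization R A M = {a \<in> carrier R. \<exists>s \<in> A - M. a \<otimes>\<^bsub>R\<^esub> s \<in> A}"

section \<open>The spaces\<close>

text \<open>A point of projective \<open>N\<close>-space is given by its representative whose first nonzero homogeneous
  coordinate is 1, and a point of the projective line by an element of \<open>K \<union> {\<infinity>}\<close>, where \<open>\<infinity>\<close>
  is \<^term>\<open>None\<close>, with homogeneous coordinates \<open>(a, 1)\<close> for \<open>a \<in> K\<close> and \<open>(1, 0)\<close> for \<open>\<infinity>\<close> (see
  \<open>t_num\<close>, \<open>t_den\<close> below). Forms are evaluated on these representatives; their zero sets and the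
  quotients of forms of equal multidegree do not depend on the choice of representatives.
  In the multidegree, slot 0 belongs to projective \<open>N\<close>-space and slot \<open>i\<close> to \<open>t\<^sub>i\<close>.\<close>

definition proj :: "nat \<Rightarrow> (nat \<Rightarrow> 'k::field alg_closure) set" where
  "proj N = {y. (\<exists>j\<le>N. y j = 1 \<and> (\<forall>i<j. y i = 0)) \<and> (\<forall>i>N. y i = 0)}"

definition unit_deg :: "nat \<Rightarrow> nat \<Rightarrow> nat" where
  "unit_deg i = (\<lambda>j. if j = i then 1 else 0)"

definition proj_coords :: "nat \<Rightarrow> ((nat \<Rightarrow> nat) \<times> ((nat \<Rightarrow> 'k::field alg_closure) \<Rightarrow> 'k alg_closure)) set" where
  "proj_coords N = {(unit_deg 0, \<lambda>y. y i) | i. i \<le> N}"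

definition quasi_projective_variety :: "nat \<Rightarrow> (nat \<Rightarrow> 'k::field alg_closure) set \<Rightarrow> bool" where
  "quasi_projective_variety N Y \<longleftrightarrow>
     irreducible_in (zariski (proj N) (proj_coords N)) Y \<and>
     (\<exists>U C. openin (zariski (proj N) (proj_coords N)) U \<and>
            closedin (zariski (proj N) (proj_coords N)) C \<and> Y = U \<inter> C)"

type_synonym 'k pt = "(nat \<Rightarrow> 'k alg_closure) \<times> 'k alg_closure \<times> 'k alg_closure option list"

definition x_of :: "'k::field pt \<Rightarrow> 'k alg_closure" where
  "x_of P = fst (snd P)"

definition t_of :: "nat \<Rightarrow> 'k::field pt \<Rightarrow> 'k alg_closure option" where
  "t_of i P = snd (snd P) ! (i - 1)"

definition t_num :: "nat \<Rightarrow> 'k::field pt \<Rightarrow> 'k alg_closure" where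
  "t_num i P = (case t_of i P of Some a \<Rightarrow> a | None \<Rightarrow> 1)"

definition t_den :: "nat \<Rightarrow> 'k::field pt \<Rightarrow> 'k alg_closure" where
  "t_den i P = (case t_of i P of Some a \<Rightarrow> 1 | None \<Rightarrow> 0)"

definition coords :: "nat \<Rightarrow> nat \<Rightarrow> ((nat \<Rightarrow> nat) \<times> ('k::field pt \<Rightarrow> 'k alg_closure)) set" where
  "coords N n = {(unit_deg 0, \<lambda>P. fst P i) | i. i \<le> N} \<union> {(\<lambda>_. 0, x_of)} \<union>
     {(unit_deg i, t_num i) | i. i \<in> {1..n}} \<union> {(unit_deg i, t_den i) | i. i \<in> {1..n}}"

text \<open>The Zariski topology of \<open>\<P>\<^sup>N \<times> \<A>\<^sup>1 \<times> (\<P>\<^sup>1)\<^sup>n\<close>.\<close>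

definition amb :: "nat \<Rightarrow> nat \<Rightarrow> 'k::field pt topology" where
  "amb N n = zariski {(y, x, t). y \<in> proj N \<and> length t = n} (coords N n)"

text \<open>\<open>Y \<times> \<Diamond>\<^sub>n\<close> and its partial compactification \<open>Y \<times> \<A>\<^sup>1 \<times> (\<P>\<^sup>1)\<^sup>n\<close>.\<close>

definition diamond :: "(nat \<Rightarrow> 'k::field alg_closure) set \<Rightarrow> nat \<Rightarrow> 'k pt set" where
  "diamond Y n = {(y, x, t). y \<in> Y \<and> length t = n \<and> Some 1 \<notin> set t}"

definition diamond_hat :: "(nat \<Rightarrow> 'k::field alg_closure) set \<Rightarrow> nat \<Rightarrow> 'k pt set" where
  "diamond_hat Y n = {(y, x, t). y \<in> Y \<and> length t = n}"

text \<open>In \<open>face Y n i j\<close> the index \<open>j\<close> is \<^term>\<open>Some 0\<close> or \<^term>\<open>None\<close> (i.e. \<open>\<infinity>\<close>).\<close>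

definition face :: "(nat \<Rightarrow> 'k::field alg_closure) set \<Rightarrow> nat \<Rightarrow> nat \<Rightarrow> 'k alg_closure option \<Rightarrow> 'k pt set" where
  "face Y n i j = {P \<in> diamond Y n. t_of i P = j}"

definition degenerate_face :: "(nat \<Rightarrow> 'k::field alg_closure) set \<Rightarrow> nat \<Rightarrow> 'k pt set" where
  "degenerate_face Y n = {P \<in> diamond Y n. x_of P = 0}"

definition codim1_faces :: "(nat \<Rightarrow> 'k::field alg_closure) set \<Rightarrow> nat \<Rightarrow> 'k pt set set" where
  "codim1_faces Y n =
     {face Y n i j | i j. i \<in> {1..n} \<and> j \<in> {Some 0, None}} \<union> {degenerate_face Y n}"

section \<open>Additive cycles\<close>

definition closure_hat :: "(nat \<Rightarrow> 'k::field alg_closure) set \<Rightarrow> nat \<Rightarrow> nat \<Rightarrow> 'k pt set \<Rightarrow> 'k pt set" where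
  "closure_hat Y N n Z = diamond_hat Y n \<inter> (amb N n closure_of Z)"

text \<open>\<open>Zh\<close> meets every face, i.e. every intersection of codimension one faces, properly.\<close>

definition proper_on_faces ::
  "(nat \<Rightarrow> 'k::field alg_closure) set \<Rightarrow> nat \<Rightarrow> nat \<Rightarrow> nat \<Rightarrow> 'k pt set \<Rightarrow> bool" where
  "proper_on_faces Y N p n Zh \<longleftrightarrow>
     (\<forall>S \<subseteq> codim1_faces Y n. S \<noteq> {} \<longrightarrow>
       (\<forall>W \<in> irr_components (amb N n) (Zh \<inter> \<Inter>S). krull_dim (amb N n) W + enat (card S) = enat p))"

text \<open>The closed points of the normalization of \<open>Zh\<close> above the closed point underlying \<open>P\<close> are the
  maximal ideals of the integral closure \<open>B\<close> of \<open>\<O>\<^bsub>Zh,P\<^esub>\<close> in the function field of \<open>Zh\<close>, and the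
  local ring of the normalization at such a point is the corresponding localization of \<open>B\<close>.\<close>

definition modulus_condition ::
  "nat \<Rightarrow> nat \<Rightarrow> nat \<Rightarrow> 'k::field pt set \<Rightarrow> bool" where
  "modulus_condition N m n Zh \<longleftrightarrow>
     (let G = coords N n; R = function_field G Zh in
      \<forall>P \<in> Zh. x_of P = 0 \<longrightarrow>
       (let B = integral_closure R (local_ring G Zh {P}) in
        \<forall>M. maximalideal M (R\<lparr>carrier := B\<rparr>) \<longrightarrow>
          (\<exists>i \<in> {1..n}. \<exists>a \<in> localization R B M.
             ratio G Zh (\<lambda>Q. t_den i Q - t_num i Q) (t_den i) =
             ratio G Zh x_of (\<lambda>_. 1) [^]\<^bsub>R\<^esub> m \<otimes>\<^bsub>R\<^esub> a)))"

definition admissible ::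
  "(nat \<Rightarrow> 'k::field alg_closure) set \<Rightarrow> nat \<Rightarrow> nat \<Rightarrow> nat \<Rightarrow> nat \<Rightarrow> 'k pt set set" where
  "admissible Y N m p n = {Z.
     closedin (subtopology (amb N n) (diamond Y n)) Z \<and>
     irreducible_in (amb N n) Z \<and> krull_dim (amb N n) Z = enat p \<and>
     (if p = 0 then \<forall>F \<in> codim1_faces Y n. Z \<inter> F = {}
      else proper_on_faces Y N p n (closure_hat Y N n Z) \<and>
           modulus_condition N m n (closure_hat Y N n Z))}"

definition cycle_group ::
  "(nat \<Rightarrow> 'k::field alg_closure) set \<Rightarrow> nat \<Rightarrow> nat \<Rightarrow> nat \<Rightarrow> nat \<Rightarrow> ('k pt set \<Rightarrow>\<^sub>0 int) monoid" where
  "cycle_group Y N m p n = free_Abelian_group (admissible Y N m p n)"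

definition forget_t :: "nat \<Rightarrow> 'k::field pt \<Rightarrow> 'k pt" where
  "forget_t i = (\<lambda>(y, x, t). (y, x, take (i - 1) t @ drop i t))"

definition degenerate_cycles ::
  "(nat \<Rightarrow> 'k::field alg_closure) set \<Rightarrow> nat \<Rightarrow> nat \<Rightarrow> nat \<Rightarrow> nat \<Rightarrow> ('k pt set \<Rightarrow>\<^sub>0 int) set" where
  "degenerate_cycles Y N m p n = generate (cycle_group Y N m p n)
     {frag_of {P \<in> diamond Y n. forget_t i P \<in> W} | i W.
        1 \<le> p \<and> i \<in> {1..n} \<and> W \<in> admissible Y N m (p - 1) (n - 1)}"

definition additive_cycles ::
  "(nat \<Rightarrow> 'k::field alg_closure) set \<Rightarrow> nat \<Rightarrow> nat \<Rightarrow> nat \<Rightarrow> nat \<Rightarrow> ('k pt set \<Rightarrow>\<^sub>0 int) set monoid" where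
  "additive_cycles Y N m p n = cycle_group Y N m p n Mod degenerate_cycles Y N m p n"

definition cycle_class ::
  "(nat \<Rightarrow> 'k::field alg_closure) set \<Rightarrow> nat \<Rightarrow> nat \<Rightarrow> nat \<Rightarrow> nat \<Rightarrow>
   ('k pt set \<Rightarrow>\<^sub>0 int) \<Rightarrow> ('k pt set \<Rightarrow>\<^sub>0 int) set" where
  "cycle_class Y N m p n z = degenerate_cycles Y N m p n #>\<^bsub>cycle_group Y N m p n\<^esub> z"

section \<open>Boundaries and the reduced complex\<close>

text \<open>The multiplicity of a component \<open>W\<close> in the intersection of \<open>Z\<close> with the Cartier divisor
  \<open>t\<^sub>i = j\<close>: the length of \<open>\<O>\<^bsub>Z,W\<^esub>\<close> modulo the local equation, \<open>t\<^sub>i\<close> for \<open>j = 0\<close> and \<open>1/t\<^sub>i\<close> for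
  \<open>j = \<infinity>\<close>.\<close>

definition face_mult ::
  "nat \<Rightarrow> nat \<Rightarrow> nat \<Rightarrow> 'k::field alg_closure option \<Rightarrow> 'k pt set \<Rightarrow> 'k pt set \<Rightarrow> nat" where
  "face_mult N n i j Z W =
     (let G = coords N n;
          R = (function_field G Z)\<lparr>carrier := local_ring G Z W\<rparr>;
          f = (if j = None then ratio G Z (t_den i) (t_num i) else ratio G Z (t_num i) (t_den i))
      in quot_length R (PIdl\<^bsub>R\<^esub> f))"

text \<open>Intersection with \<open>F\<^sub>i\<^sup>j\<close>, which is identified with \<open>Y \<times> \<Diamond>\<^bsub>n-1\<^esub>\<close> by forgetting \<open>t\<^sub>i\<close>.\<close>

definition face_map ::
  "(nat \<Rightarrow> 'k::field alg_closure) set \<Rightarrow> nat \<Rightarrow> nat \<Rightarrow> nat \<Rightarrow> 'k alg_closure option \<Rightarrow>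
   ('k pt set \<Rightarrow>\<^sub>0 int) \<Rightarrow> ('k pt set \<Rightarrow>\<^sub>0 int)" where
  "face_map Y N n i j = frag_extend (\<lambda>Z.
     \<Sum>W \<in> irr_components (amb N n) (Z \<inter> face Y n i j).
       frag_cmul (int (face_mult N n i j Z W)) (frag_of (forget_t i ` W)))"

text \<open>The cycles representing the elements of the reduced group: those whose faces, except the last
  face at 0, vanish in the group of cycles modulo degenerate ones. The individual face maps
  do not descend to arbitrary representatives modulo degenerate cycles (only the differences
  of the faces at 0 and at \<open>\<infinity>\<close> do), so the kernels are taken on cycles; on the representatives
  selected here the class of the last face at 0 depends only on the class of the cycle.
  Every class so represented contains exactly one cycle for which these faces vanish as cycles.\<close>

definition reduced_cycles ::
  "(nat \<Rightarrow> 'k::field alg_closure) set \<Rightarrow> nat \<Rightarrow> nat \<Rightarrow> nat \<Rightarrow> nat \<Rightarrow> ('k pt set \<Rightarrow>\<^sub>0 int) set" where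
  "reduced_cycles Y N m p n = {z \<in> carrier (cycle_group Y N m p n).
     (\<forall>i \<in> {1..n}. \<forall>j \<in> {Some 0, None}. (i, j) \<noteq> (n, Some 0) \<longrightarrow>
        cycle_class Y N m (p - 1) (n - 1) (face_map Y N n i j z) =
        \<one>\<^bsub>additive_cycles Y N m (p - 1) (n - 1)\<^esub>)}"

definition last_face ::
  "(nat \<Rightarrow> 'k::field alg_closure) set \<Rightarrow> nat \<Rightarrow> nat \<Rightarrow> ('k pt set \<Rightarrow>\<^sub>0 int) \<Rightarrow> ('k pt set \<Rightarrow>\<^sub>0 int)" where
  "last_face Y N n = face_map Y N n n (Some 0)"

section \<open>The Connes operator\<close>

definition insert_inv_x :: "nat \<Rightarrow> 'k::field pt \<Rightarrow> 'k pt" where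
  "insert_inv_x l = (\<lambda>(y, x, t). (y, x, take (l - 1) t @ Some (1 / x) # drop (l - 1) t))"

text \<open>The closure of the image, with the points where \<open>x = 0\<close> (where \<open>1/x\<close> is not in \<open>K\<close>; note that
  \<open>1/0 = 0\<close> in HOL) or \<open>1/x = 1\<close> removed; zero if no point remains. The rational map is injective
  with inverse given by forgetting a coordinate, so no multiplicities occur.\<close>

definition connes_part ::
  "(nat \<Rightarrow> 'k::field alg_closure) set \<Rightarrow> nat \<Rightarrow> nat \<Rightarrow> nat \<Rightarrow>
   ('k pt set \<Rightarrow>\<^sub>0 int) \<Rightarrow> ('k pt set \<Rightarrow>\<^sub>0 int)" where
  "connes_part Y N n l = frag_extend (\<lambda>Z.
     let V = insert_inv_x l ` {P \<in> Z. x_of P \<noteq> 0 \<and> x_of P \<noteq> 1}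
     in if V = {} then 0
        else frag_of (diamond Y (n + 1) \<inter> (amb N (n + 1) closure_of V)))"

definition connes ::
  "(nat \<Rightarrow> 'k::field alg_closure) set \<Rightarrow> nat \<Rightarrow> nat \<Rightarrow> ('k pt set \<Rightarrow>\<^sub>0 int) \<Rightarrow> ('k pt set \<Rightarrow>\<^sub>0 int)" where
  "connes Y N n z = (\<Sum>l = 1..n + 1. frag_cmul ((-1) ^ l) (connes_part Y N n l z))"

end

theory Submission
  imports Defs "HOL-Library.Function_Algebras"
begin

text \<open>
  The identity holds for cycles, not only modulo degenerate ones. For an integral \<open>Z\<close> and \<open>l \<le> n\<close>
  the cycle \<open>\<delta>\<^sub>l Z\<close> is the image of \<open>Z \<setminus> {x = 1}\<close> under the closed embedding inserting \<open>1/x\<close>, with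
  \<open>1/0 = \<infinity>\<close>, at position \<open>l\<close>. It carries the components of \<open>Z \<inter> {t\<^sub>n = 0}\<close> not contained in \<open>x = 1\<close>,
  with their multiplicities, to those of \<open>\<delta>\<^sub>l Z \<inter> {t\<^bsub>n+1\<^esub> = 0}\<close>, and by proper intersection none of
  them is contained in \<open>x = 0\<close>, which \<open>\<delta>\<^sub>l\<close> would discard. Hence \<open>\<partial>' \<delta>\<^sub>l Z = \<delta>\<^sub>l \<partial>' Z\<close>; and
  \<open>\<partial>' \<delta>\<^bsub>n+1\<^esub> Z = 0\<close> because \<open>1/x\<close> does not vanish. As a sum over an infinite set is \<open>0\<close> in HOL, the
  finiteness of the number of components is needed; it is derived from Hilbert's basis theorem.
\<close>

section \<open>Noetherian rings of functions\<close>

text \<open>The multiplicities in \<open>face_mult\<close> are lengths of quotients of local rings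
  of fractions of forms, so an identity of cycles requires an isomorphism of local rings and not
  only a bijection of components. The comparison map is the one forgetting t_l: it pulls coordinate
  functions back to coordinate functions, whereas the insertion of 1/x does not, because the stored
  representative (1/x, 1) is not polynomial in x. Multiplication by a power of x repairs this, and
  as the power depends only on the multidegree, it cancels in every fraction. The same insertion
  with the constant 0 in place of 1/x describes the identification of the face t_n = 0 with a space
  in one coordinate less. Hilbert's theorem is proved for subsets of a ring type, because the
  algebra generated by the coordinate functions is a subset of a function type and not a type by
  itself.\<close>

definition subring_set :: "'a::comm_ring_1 set \<Rightarrow> bool" where
  "subring_set R \<longleftrightarrow> 0 \<in> R \<and> 1 \<in> R \<and> (\<forall>a\<in>R. \<forall>b\<in>R. a + b \<in> R \<and> a * b \<in> R \<and> - a \<in> R)"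

text \<open>Built one summand at a time, so that facts about finite linear combinations follow by
  induction without families of coefficients.\<close>

inductive_set ideal_hull :: "'a::comm_ring_1 set \<Rightarrow> 'a set \<Rightarrow> 'a set" for R A where
  zero: "0 \<in> ideal_hull R A"
| step: "a \<in> ideal_hull R A \<Longrightarrow> r \<in> R \<Longrightarrow> b \<in> A \<Longrightarrow> a + r * b \<in> ideal_hull R A"

text \<open>This form of the chain condition passes to homomorphic images by lifting sequences term
  by term, and it applies directly to a sequence of forms attached to a descending chain of closed
  sets.\<close>

definition noetherian_set :: "'a::comm_ring_1 set \<Rightarrow> bool" where
  "noetherian_set R \<longleftrightarrow> (\<forall>f :: nat \<Rightarrow> 'a. range f \<subseteq> R \<longrightarrow> (\<exists>n. f n \<in> ideal_hull R (f ` {..<n})))"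

lemma ideal_hull_add:
  "b \<in> ideal_hull R A \<Longrightarrow> a \<in> ideal_hull R A \<Longrightarrow> a + b \<in> ideal_hull R A"
  by (induction rule: ideal_hull.induct) (auto simp: add.assoc[symmetric] intro: ideal_hull.intros)

lemma ideal_hull_mult:
  assumes "subring_set R" "r \<in> R" "a \<in> ideal_hull R A"
  shows "r * a \<in> ideal_hull R A"
  using assms(3)
proof induction
  case (step a s b)
  then have "r * a + (r * s) * b \<in> ideal_hull R A"
    using assms(1,2) by (intro ideal_hull.step) (auto simp: subring_set_def)
  then show ?case by (simp add: algebra_simps)
qed (simp add: ideal_hull.zero)

lemma ideal_hull_base: "subring_set R \<Longrightarrow> a \<in> A \<Longrightarrow> a \<in> ideal_hull R A"
  using ideal_hull.step[OF ideal_hull.zero, of 1 R a A] by (simp add: subring_set_def)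

lemma ideal_hull_least:
  assumes "subring_set R" "A \<subseteq> ideal_hull R B"
  shows "ideal_hull R A \<subseteq> ideal_hull R B"
proof
  show "x \<in> ideal_hull R B" if "x \<in> ideal_hull R A" for x
    using that
    by induction (use assms in \<open>auto intro: ideal_hull.zero ideal_hull_add ideal_hull_mult\<close>)
qed

lemma ideal_hull_mono: "subring_set R \<Longrightarrow> A \<subseteq> B \<Longrightarrow> ideal_hull R A \<subseteq> ideal_hull R B"
  by (intro ideal_hull_least) (auto intro: ideal_hull_base)

lemma ideal_hull_subset: "subring_set R \<Longrightarrow> A \<subseteq> R \<Longrightarrow> ideal_hull R A \<subseteq> R"
proof
  show "x \<in> R" if "subring_set R" "A \<subseteq> R" "x \<in> ideal_hull R A" for x
    using that(3) by induction (use that(1,2) in \<open>auto simp: subring_set_def\<close>)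
qed

text \<open>Each element of the hull uses finitely many terms of the sequence, hence lies in the
  hull of an initial segment; the segments increase, so finitely many elements fit into one of
  them.\<close>

lemma ideal_hull_range_finite:
  assumes "subring_set R" "finite A" "A \<subseteq> ideal_hull R (range (f :: nat \<Rightarrow> _))"
  obtains n where "A \<subseteq> ideal_hull R (f ` {..<n})"
proof -
  have mono: "ideal_hull R (f ` {..<m}) \<subseteq> ideal_hull R (f ` {..<n})" if "m \<le> n" for m n
    using that by (intro ideal_hull_mono assms(1)) auto
  have "\<exists>n. x \<in> ideal_hull R (f ` {..<n})" if "x \<in> ideal_hull R (range f)" for x
    using that
  proof induction
    case (step a r b)
    then obtain n i where "a \<in> ideal_hull R (f ` {..<n})" "b = f i" by auto
    then have "a + r * b \<in> ideal_hull R (f ` {..<max n (Suc i)})"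
      using mono[of n "max n (Suc i)"] step(2) by (intro ideal_hull.step) auto
    then show ?case by blast
  qed (auto intro: ideal_hull.zero)
  then have "\<exists>N. \<forall>x\<in>A. x \<in> ideal_hull R (f ` {..<N x})"
    using assms(3) by (intro bchoice) blast
  then obtain N where N: "\<forall>x\<in>A. x \<in> ideal_hull R (f ` {..<N x})" by blast
  have "A \<subseteq> ideal_hull R (f ` {..<Max (N ` A)})"
    using N mono assms(2) Max_ge[of "N ` A"] by blast
  then show ?thesis by (rule that)
qed

section \<open>Hilbert's basis theorem\<close>

definition poly_over :: "'a::comm_ring_1 set \<Rightarrow> 'a poly set" where
  "poly_over R = {q. \<forall>i. coeff q i \<in> R}"

lemma subring_set_sum: "subring_set R \<Longrightarrow> (\<And>i. i \<in> I \<Longrightarrow> f i \<in> R) \<Longrightarrow> sum f I \<in> R"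
  by (induction I rule: infinite_finite_induct) (auto simp: subring_set_def)

lemma subring_set_poly_over:
  assumes "subring_set R"
  shows "subring_set (poly_over R)"
proof -
  have [simp]: "0 \<in> R" "1 \<in> R" using assms by (auto simp: subring_set_def)
  have closed: "\<And>a b. a \<in> R \<Longrightarrow> b \<in> R \<Longrightarrow> a + b \<in> R"
    "\<And>a b. a \<in> R \<Longrightarrow> b \<in> R \<Longrightarrow> a * b \<in> R" "\<And>a. a \<in> R \<Longrightarrow> - a \<in> R"
    using assms by (auto simp: subring_set_def)
  have "coeff (p * q) i \<in> R" if "p \<in> poly_over R" "q \<in> poly_over R" for p q i
    unfolding coeff_mult
    by (rule subring_set_sum[OF assms]) (use that closed in \<open>auto simp: poly_over_def\<close>)
  then show ?thesis
    unfolding subring_set_def[of "poly_over R"]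
    using assms closed by (auto simp: poly_over_def coeff_1 subring_set_def)
qed

text \<open>The classical argument by minimal degrees. If no term lies in the ideal of its
  predecessors, then no finite subset generates the ideal \<open>I\<close> of the sequence, and one
  can choose successively \<open>g n\<close> of least degree in \<open>I\<close> outside the ideal
  of the earlier choices. A relation between the leading coefficients, supplied by \<open>R\<close>,
  cancels the top term of some \<open>g n\<close> and contradicts minimality.\<close>

theorem noetherian_set_poly_over:
  fixes R :: "'a::comm_ring_1 set"
  assumes R: "subring_set R" and noeth: "noetherian_set R"
  shows "noetherian_set (poly_over R)"
  unfolding noetherian_set_def
proof (intro allI impI, rule ccontr)
  let ?P = "poly_over R"
  fix f :: "nat \<Rightarrow> 'a poly"
  assume f: "range f \<subseteq> ?P" and bad: "\<nexists>n. f n \<in> ideal_hull ?P (f ` {..<n})"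
  note P = subring_set_poly_over[OF R]
  define I where "I = ideal_hull ?P (range f)"
  have IP: "I \<subseteq> ?P" unfolding I_def using P f by (rule ideal_hull_subset)
  have nonempty: "I - ideal_hull ?P A \<noteq> {}" if A: "finite A" "A \<subseteq> I" for A
  proof -
    obtain n where "A \<subseteq> ideal_hull ?P (f ` {..<n})"
      using ideal_hull_range_finite[OF P] A unfolding I_def by blast
    then have "f n \<notin> ideal_hull ?P A" using ideal_hull_least[OF P] bad by blast
    moreover have "f n \<in> I" unfolding I_def using P by (rule ideal_hull_base) auto
    ultimately show ?thesis by blast
  qed
  define pick where "pick A = arg_min_on degree (I - ideal_hull ?P A)" for A
  have pick: "pick A \<in> I - ideal_hull ?P A"
    "q \<in> I - ideal_hull ?P A \<Longrightarrow> degree (pick A) \<le> degree q" if "finite A" "A \<subseteq> I" for A q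
  proof -
    have "is_arg_min degree (\<lambda>q. q \<in> I - ideal_hull ?P A) (pick A)"
      unfolding pick_def arg_min_on_def using nonempty[OF that]
      by (metis arg_min_natI all_not_in_conv is_arg_min_arg_min_nat)
    then show "pick A \<in> I - ideal_hull ?P A"
      "q \<in> I - ideal_hull ?P A \<Longrightarrow> degree (pick A) \<le> degree q"
      by (auto simp: is_arg_min_linorder)
  qed
  define A where "A = rec_nat {} (\<lambda>_ A. insert (pick A) A)"
  define g where "g n = pick (A n)" for n
  have A_Suc: "A (Suc n) = insert (g n) (A n)" and A_0: "A 0 = {}" for n
    by (auto simp: A_def g_def)
  have A_eq: "A n = g ` {..<n}" for n
    by (induction n) (auto simp: A_Suc A_0 lessThan_Suc)
  have A: "finite (A n) \<and> A n \<subseteq> I" for n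
    using pick by (induction n) (auto simp: A_Suc A_0 g_def)
  have g: "g n \<in> I" "g n \<notin> ideal_hull ?P (A n)" for n
    using pick(1) A unfolding g_def by blast+
  have g_min: "degree (g n) \<le> degree q" if "q \<in> I" "q \<notin> ideal_hull ?P (A n)" for n q
    using pick(2) A that unfolding g_def by blast
  have g_le: "degree (g i) \<le> degree (g n)" if "i < n" for i n
  proof (rule g_min)
    have "A i \<subseteq> A n" using that by (auto simp: A_eq)
    from ideal_hull_mono[OF P this] show "g n \<notin> ideal_hull ?P (A i)" using g(2)[of n] by auto
  qed (rule g)
  have "range (\<lambda>i. lead_coeff (g i)) \<subseteq> R"
    using g(1) IP by (auto simp: poly_over_def)
  then obtain n where n: "lead_coeff (g n) \<in> ideal_hull R ((\<lambda>i. lead_coeff (g i)) ` {..<n})"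
    using noeth unfolding noetherian_set_def by meson
  define d where "d = degree (g n)"
  \<comment> \<open>The condition is on the coefficient at \<open>d\<close>, not on the leading one,
    because partial sums may lose their top term. The degrees of \<open>g\<close> do not decrease,
    so every \<open>g i\<close> with \<open>i < n\<close> can be shifted up to degree
    \<open>d\<close>.\<close>
  have "\<exists>q\<in>ideal_hull ?P (A n). degree q \<le> d \<and> coeff q d = x"
    if "x \<in> ideal_hull R ((\<lambda>i. lead_coeff (g i)) ` {..<n})" for x
    using that
  proof induction
    case (step a r b)
    then obtain q i where q: "q \<in> ideal_hull ?P (A n)" "degree q \<le> d" "coeff q d = a"
      and i: "i < n" "b = lead_coeff (g i)" by auto
    have le: "degree (g i) \<le> d" using g_le i by (simp add: d_def)
    let ?q = "q + monom r (d - degree (g i)) * g i"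
    have "monom r (d - degree (g i)) \<in> ?P"
      using step(2) R by (auto simp: poly_over_def subring_set_def)
    then have "?q \<in> ideal_hull ?P (A n)"
      using q i by (intro ideal_hull.step) (auto simp: A_eq)
    moreover have "degree ?q \<le> d"
      using q le by (intro degree_add_le order.trans[OF degree_mult_le])
        (auto simp: le_diff_conv2 intro!: order.trans[OF add_right_mono[OF degree_monom_le]])
    moreover have "coeff ?q d = a + r * b"
      using q le i by (simp add: coeff_monom_mult)
    ultimately show ?case by blast
  qed (auto intro!: bexI[of _ 0] ideal_hull.zero)
  then obtain q where q: "q \<in> ideal_hull ?P (A n)" "degree q \<le> d" "coeff q d = lead_coeff (g n)"
    using n by blast
  have "ideal_hull ?P (A n) \<subseteq> I"
    unfolding I_def using A[of n] P by (intro ideal_hull_least) (auto simp: I_def)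
  moreover have neg: "- q \<in> ideal_hull ?P (A n)"
    using ideal_hull_mult[OF P _ q(1), of "- 1"] P by (auto simp: subring_set_def)
  ultimately have "g n + (- q) \<in> I"
    using g(1) unfolding I_def by (intro ideal_hull_add) auto
  moreover have notin: "g n + (- q) \<notin> ideal_hull ?P (A n)"
    using ideal_hull_add[OF q(1), of "g n + (- q)"] g(2)[of n] by auto
  ultimately have "d \<le> degree (g n + (- q))" unfolding d_def by (rule g_min)
  moreover have "degree (g n + (- q)) \<le> d"
    using q by (intro degree_add_le) (auto simp: d_def)
  \<comment> \<open>Minimality forces the difference to have degree exactly \<open>d\<close>, yet
    its coefficient at \<open>d\<close> is 0. Only the zero polynomial allows both, and it lies in
    every ideal.\<close>
  ultimately have "lead_coeff (g n + (- q)) = 0" using q by (simp add: d_def)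
  then have "g n + (- q) = 0" by (metis leading_coeff_0_iff)
  then show False using notin ideal_hull.zero by metis
qed

text \<open>The witness is R[x], the image of the polynomial ring under evaluation at
  \<open>x\<close>.\<close>

lemma noetherian_set_adjoin:
  fixes R :: "'a::comm_ring_1 set"
  assumes R: "subring_set R" and noeth: "noetherian_set R"
  obtains R' where "subring_set R'" "noetherian_set R'" "insert x R \<subseteq> R'"
proof
  let ?P = "poly_over R" and ?h = "\<lambda>q. poly q x"
  note P = subring_set_poly_over[OF R]
  have closed: "0 \<in> ?P" "1 \<in> ?P" "\<And>a b. a \<in> ?P \<Longrightarrow> b \<in> ?P \<Longrightarrow> a + b \<in> ?P \<and> a * b \<in> ?P \<and> - a \<in> ?P"
    using P by (auto simp: subring_set_def)
  show "subring_set (?h ` ?P)"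
    unfolding subring_set_def
  proof (intro conjI ballI)
    show "0 \<in> ?h ` ?P" using closed(1) by (rule image_eqI[rotated]) simp
    show "1 \<in> ?h ` ?P" using closed(2) by (rule image_eqI[rotated]) simp
    fix a b assume "a \<in> ?h ` ?P" "b \<in> ?h ` ?P"
    then obtain p q where pq: "p \<in> ?P" "q \<in> ?P" and ab: "a = ?h p" "b = ?h q" by blast
    show "a + b \<in> ?h ` ?P" by (rule image_eqI[of _ _ "p + q"]) (use closed(3)[OF pq] ab in auto)
    show "a * b \<in> ?h ` ?P" by (rule image_eqI[of _ _ "p * q"]) (use closed(3)[OF pq] ab in auto)
    show "- a \<in> ?h ` ?P" by (rule image_eqI[of _ _ "- p"]) (use closed(3)[OF pq] ab in auto)
  qed
  have hull: "?h q \<in> ideal_hull (?h ` ?P) (?h ` A)" if "q \<in> ideal_hull ?P A" for q A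
    using that by induction (auto intro: ideal_hull.intros)
  show "noetherian_set (?h ` ?P)"
    unfolding noetherian_set_def
  proof (intro allI impI)
    fix f :: "nat \<Rightarrow> 'a" assume "range f \<subseteq> ?h ` ?P"
    then have "\<forall>n. \<exists>q. q \<in> ?P \<and> f n = ?h q" by blast
    then obtain q where q: "\<And>n. q n \<in> ?P" "\<And>n. f n = ?h (q n)" by metis
    then obtain n where "q n \<in> ideal_hull ?P (q ` {..<n})"
      using noetherian_set_poly_over[OF R noeth] unfolding noetherian_set_def by blast
    from hull[OF this] show "\<exists>n. f n \<in> ideal_hull (?h ` ?P) (f ` {..<n})"
      using q(2) by (auto simp: image_image)
  qed
  have "r \<in> ?h ` ?P" if "r \<in> R" for r
    using that R
    by (intro image_eqI[of _ _ "[:r:]"])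
       (auto simp: poly_over_def subring_set_def coeff_pCons split: nat.split)
  moreover have "x \<in> ?h ` ?P"
    using R by (intro image_eqI[of _ _ "[:0, 1:]"])
       (auto simp: poly_over_def subring_set_def coeff_pCons split: nat.split)
  ultimately show "insert x R \<subseteq> ?h ` ?P" by blast
qed

section \<open>Finitely generated algebras of functions over k\<close>

lemma noetherian_set_adjoin_finite:
  assumes "finite C" "subring_set R" "noetherian_set R"
  obtains R' where "subring_set R'" "noetherian_set R'" "R \<union> C \<subseteq> R'"
  using assms(1)
proof (induction arbitrary: thesis)
  case empty
  then show ?case using assms by auto
next
  case (insert x C)
  obtain R' where R': "subring_set R'" "noetherian_set R'" "R \<union> C \<subseteq> R'"
    using insert.IH by blast
  obtain R'' where "subring_set R''" "noetherian_set R''" "insert x R' \<subseteq> R''"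
    using noetherian_set_adjoin[OF R'(1,2)] by blast
  with R' show ?case by (intro insert.prems[of R'']) auto
qed

text \<open>The constants form a copy of the field k: of two of them, either the first is 0 or the
  second is a multiple of it.\<close>

lemma constants_noetherian:
  fixes C :: "('p \<Rightarrow> 'k::field alg_closure) set"
  defines "C \<equiv> {\<lambda>_. to_ac c | c. True}"
  shows "subring_set C" "noetherian_set C"
proof -
  show "subring_set C"
    unfolding subring_set_def
  proof (intro conjI ballI)
    show "0 \<in> C" unfolding C_def by (auto intro!: exI[of _ 0])
    show "1 \<in> C" unfolding C_def by (auto intro!: exI[of _ 1])
    fix a b assume "a \<in> C" "b \<in> C"
    then obtain c d where "a = (\<lambda>_. to_ac c)" "b = (\<lambda>_. to_ac d)" by (auto simp: C_def)
    then have "a + b = (\<lambda>_. to_ac (c + d))" "a * b = (\<lambda>_. to_ac (c * d))" "- a = (\<lambda>_. to_ac (- c))"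
      by auto
    then show "a + b \<in> C" "a * b \<in> C" "- a \<in> C" unfolding C_def by blast+
  qed
  show "noetherian_set C"
    unfolding noetherian_set_def
  proof (intro allI impI)
    fix f :: "nat \<Rightarrow> 'p \<Rightarrow> 'k alg_closure" assume "range f \<subseteq> C"
    then obtain a b where ab: "f 0 = (\<lambda>_. to_ac a)" "f 1 = (\<lambda>_. to_ac b)"
      unfolding C_def by blast
    show "\<exists>n. f n \<in> ideal_hull C (f ` {..<n})"
    proof (cases "a = 0")
      case True
      then have "f 0 = 0" using ab by auto
      then have "f 0 \<in> ideal_hull C (f ` {..<0})" using ideal_hull.zero by metis
      then show ?thesis ..
    next
      case False
      then have "f 1 = 0 + (\<lambda>_. to_ac (b / a)) * f 0" using ab by (intro ext) simp
      moreover have "0 + (\<lambda>_. to_ac (b / a)) * f 0 \<in> ideal_hull C (f ` {..<1})"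
        by (intro ideal_hull.intros) (auto simp: C_def intro!: exI[of _ "b / a"])
      ultimately show ?thesis by metis
    qed
  qed
qed

text \<open>With the grading forgotten, forms of all multidegrees lie in the k-algebra generated by
  the finitely many coordinate functions.\<close>

lemma mform_subset_noetherian:
  fixes G :: "((nat \<Rightarrow> nat) \<times> ('p \<Rightarrow> 'k::field alg_closure)) set"
  assumes "finite G"
  obtains R where "subring_set R" "noetherian_set R" "\<And>d F. mform G d F \<Longrightarrow> F \<in> R"
proof -
  define C :: "('p \<Rightarrow> 'k alg_closure) set" where "C = {\<lambda>_. to_ac c | c. True}"
  obtain R where R: "subring_set R" "noetherian_set R" "C \<union> snd ` G \<subseteq> R"
    using noetherian_set_adjoin_finite[of "snd ` G" C] assms constants_noetherian
    unfolding C_def by blast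
  have "F \<in> R" if "mform G d F" for d F
    using that
  proof induction
    case (coord d f)
    then show ?case using R(3) by force
  next
    case (add d F F')
    then have "F + F' \<in> R" using R(1) by (auto simp: subring_set_def)
    then show ?case by (simp add: plus_fun_def)
  next
    case (mult d F e F')
    then have "F * F' \<in> R" using R(1) by (auto simp: subring_set_def)
    then show ?case by (simp add: times_fun_def)
  qed (use R(3) in \<open>auto simp: C_def\<close>)
  with R show ?thesis using that by blast
qed


no_notation Congruence.eq_closure_of (\<open>closure'_of\<index>\<close>)

section \<open>Irreducible components\<close>

lemma irreducible_in_finite_cover:
  assumes "irreducible_in T S" "finite \<C>" "\<And>C. C \<in> \<C> \<Longrightarrow> closedin T C" "S \<subseteq> \<Union>\<C>"
  shows "\<exists>C\<in>\<C>. S \<subseteq> C"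
  using assms(2-4)
proof (induction \<C> rule: finite_induct)
  case empty
  then show ?case using assms(1) by (auto simp: irreducible_in_def)
next
  case (insert C \<C>)
  then have "closedin T C" "closedin T (\<Union>\<C>)" "S \<subseteq> C \<union> \<Union>\<C>"
    by (auto intro: closedin_Union)
  then have "S \<subseteq> C \<or> S \<subseteq> \<Union>\<C>" using assms(1) unfolding irreducible_in_def by blast
  then show ?case using insert by blast
qed

lemma irreducible_in_image:
  assumes "irreducible_in T S" "continuous_map T T' f"
  shows "irreducible_in T' (f ` S)"
  unfolding irreducible_in_def
proof (intro conjI allI impI)
  have S: "S \<subseteq> topspace T" "S \<noteq> {}" using assms(1) by (auto simp: irreducible_in_def)
  show "f ` S \<subseteq> topspace T'" using S assms(2) continuous_map_image_subset_topspace by blast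
  show "f ` S \<noteq> {}" using S by simp
  fix A B assume *: "closedin T' A \<and> closedin T' B \<and> f ` S \<subseteq> A \<union> B"
  let ?p = "\<lambda>A. {x \<in> topspace T. f x \<in> A}"
  have "closedin T (?p A)" "closedin T (?p B)" "S \<subseteq> ?p A \<union> ?p B"
    using * S closedin_continuous_map_preimage[OF assms(2)] by auto
  then have "S \<subseteq> ?p A \<or> S \<subseteq> ?p B" using assms(1) by (simp add: irreducible_in_def)
  then show "f ` S \<subseteq> A \<or> f ` S \<subseteq> B" by blast
qed

text \<open>\<open>S\<close> is covered by two closed sets, the closure of its part in
  \<open>U\<close> and the complement of \<open>U\<close>, and the second does not contain
  it.\<close>

lemma irreducible_in_Int_open_dense:
  assumes "irreducible_in T S" "openin T U" "S \<inter> U \<noteq> {}"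
  shows "S \<subseteq> T closure_of (S \<inter> U)"
proof -
  have "S \<subseteq> T closure_of (S \<inter> U) \<union> (topspace T - U)"
    using assms(1) closure_of_subset[of "S \<inter> U" T] by (auto simp: irreducible_in_def)
  moreover have "closedin T (topspace T - U)" using assms(2) by blast
  ultimately have "S \<subseteq> T closure_of (S \<inter> U) \<or> S \<subseteq> topspace T - U"
    using assms(1) unfolding irreducible_in_def by (meson closedin_closure_of)
  then show ?thesis using assms(3) by blast
qed

lemma irreducible_in_Int_open:
  assumes "irreducible_in T S" "openin T U" "S \<inter> U \<noteq> {}"
  shows "irreducible_in T (S \<inter> U)"
  unfolding irreducible_in_def
proof (intro conjI allI impI)
  show "S \<inter> U \<subseteq> topspace T" "S \<inter> U \<noteq> {}" using assms by (auto simp: irreducible_in_def)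
  fix A B assume *: "closedin T A \<and> closedin T B \<and> S \<inter> U \<subseteq> A \<union> B"
  then have "T closure_of (S \<inter> U) \<subseteq> A \<union> B" by (intro closure_of_minimal) auto
  then have "S \<subseteq> A \<union> B" using irreducible_in_Int_open_dense[OF assms] by blast
  then show "S \<inter> U \<subseteq> A \<or> S \<inter> U \<subseteq> B" using * assms(1) unfolding irreducible_in_def by blast
qed

lemma irreducible_in_intermediate_closure:
  assumes "irreducible_in T S" "S \<subseteq> S'" "S' \<subseteq> T closure_of S"
  shows "irreducible_in T S'"
  unfolding irreducible_in_def
proof (intro conjI allI impI)
  show "S' \<subseteq> topspace T" using assms(3) closure_of_subset_topspace by (rule order.trans)
  show "S' \<noteq> {}" using assms(1,2) by (auto simp: irreducible_in_def)
  fix A B assume *: "closedin T A \<and> closedin T B \<and> S' \<subseteq> A \<union> B"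
  then have "S \<subseteq> A \<or> S \<subseteq> B" using assms(1,2) unfolding irreducible_in_def by blast
  then have "T closure_of S \<subseteq> A \<or> T closure_of S \<subseteq> B" using * by (meson closure_of_minimal)
  then show "S' \<subseteq> A \<or> S' \<subseteq> B" using assms(3) by blast
qed

lemma irr_componentsD:
  assumes "W \<in> irr_components T S"
  shows "irreducible_in T W" "W \<subseteq> S"
    and "\<And>V. irreducible_in T V \<Longrightarrow> W \<subseteq> V \<Longrightarrow> V \<subseteq> S \<Longrightarrow> V = W"
  using assms by (auto simp: irr_components_def)

text \<open>Maximality in \<open>irr_components\<close> ranges over all irreducible subsets, closed
  or not; closedness in \<open>S\<close> follows because taking the closure inside \<open>S\<close>
  keeps a set irreducible.\<close>

lemma irr_component_closed:
  assumes "W \<in> irr_components T S"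
  shows "S \<inter> T closure_of W = W"
proof (rule irr_componentsD(3)[OF assms])
  note W = irr_componentsD[OF assms]
  have "W \<subseteq> T closure_of W" using W(1) by (simp add: closure_of_subset irreducible_in_def)
  with W(2) show "W \<subseteq> S \<inter> T closure_of W" by blast
  with W(1) show "irreducible_in T (S \<inter> T closure_of W)"
    by (rule irreducible_in_intermediate_closure) simp
qed simp

lemma irr_components_empty: "irr_components T {} = {}"
  by (auto simp: irr_components_def irreducible_in_def)

text \<open>The inverse correspondence sends a component of \<open>S \<inter> U\<close> to its
  closure in \<open>S\<close>, since nonempty open parts of irreducible sets are dense.\<close>

lemma irr_components_Int_open:
  assumes "openin T U"
  shows "irr_components T (S \<inter> U) = (\<lambda>W. W \<inter> U) ` {W \<in> irr_components T S. W \<inter> U \<noteq> {}}"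
    (is "?L = ?R")
proof (intro equalityI subsetI)
  fix W assume "W \<in> ?R"
  then obtain V where V: "V \<in> irr_components T S" "V \<inter> U \<noteq> {}" "W = V \<inter> U" by blast
  note V' = irr_componentsD[OF V(1)]
  have "V' = V \<inter> U" if V'': "irreducible_in T V'" "V \<inter> U \<subseteq> V'" "V' \<subseteq> S \<inter> U" for V'
  proof -
    have "V \<subseteq> T closure_of (V \<inter> U)" using irreducible_in_Int_open_dense[OF V'(1) assms V(2)] .
    also have "\<dots> \<subseteq> T closure_of V'" using V''(2) by (rule closure_of_mono)
    finally have "V \<subseteq> S \<inter> T closure_of V'" using V'(2) by blast
    moreover have sub: "V' \<subseteq> S \<inter> T closure_of V'"
      using V''(1,3) by (auto simp: irreducible_in_def in_closure_of)
    moreover have "irreducible_in T (S \<inter> T closure_of V')"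
      using V''(1) sub by (rule irreducible_in_intermediate_closure) simp
    ultimately have "S \<inter> T closure_of V' = V" using V'(3) by blast
    then show ?thesis using V''(2,3) sub by blast
  qed
  moreover have "irreducible_in T (V \<inter> U)" using irreducible_in_Int_open[OF V'(1) assms V(2)] .
  ultimately show "W \<in> ?L" using V'(2) V(3) by (auto simp: irr_components_def)
next
  fix W assume W: "W \<in> ?L"
  note W' = irr_componentsD[OF W]
  define V where "V = S \<inter> T closure_of W"
  have sub: "W \<subseteq> V"
    using W'(1,2) by (auto simp: V_def irreducible_in_def in_closure_of)
  have VU: "V \<inter> U = W" using irr_component_closed[OF W] by (auto simp: V_def)
  have ne: "W \<noteq> {}" using W'(1) by (simp add: irreducible_in_def)
  have "irreducible_in T V"
    using W'(1) sub by (rule irreducible_in_intermediate_closure) (simp add: V_def)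
  moreover have "V' = V" if V': "irreducible_in T V'" "V \<subseteq> V'" "V' \<subseteq> S" for V'
  proof -
    have "V' \<inter> U \<noteq> {}" using V' sub VU ne by blast
    note VU' = irreducible_in_Int_open[OF V'(1) assms this] irreducible_in_Int_open_dense[OF V'(1) assms this]
    have "V' \<inter> U = W" using W'(3)[OF VU'(1)] V'(2,3) VU by blast
    with VU'(2) V'(2,3) show ?thesis by (auto simp: V_def)
  qed
  ultimately have "V \<in> irr_components T S" by (auto simp: irr_components_def V_def)
  then show "W \<in> ?R" using VU ne by blast
qed

text \<open>\<open>g\<close> is a continuous left inverse, so \<open>f\<close> is a homeomorphism
  onto its image and irreducibility can be transported both ways.\<close>

lemma irr_components_image:
  assumes f: "continuous_map T T' f" and g: "continuous_map T' T g"
    and gf: "\<And>x. x \<in> topspace T \<Longrightarrow> g (f x) = x" and S: "S \<subseteq> topspace T"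
  shows "irr_components T' (f ` S) = (`) f ` irr_components T S"
proof (intro equalityI subsetI)
  have gfV: "g ` f ` V = V" if "V \<subseteq> S" for V
    using that S gf by (force simp: image_image)
  have fgV: "f ` g ` V = V" "g ` V \<subseteq> S" if "V \<subseteq> f ` S" for V
    using that S gf by (force simp: image_image)+
  {
    fix W assume "W \<in> irr_components T' (f ` S)"
    note W = irr_componentsD[OF this]
    have "irreducible_in T (g ` W)" using W(1) g by (rule irreducible_in_image)
    moreover have "V = g ` W" if V: "irreducible_in T V" "g ` W \<subseteq> V" "V \<subseteq> S" for V
    proof -
      have "irreducible_in T' (f ` V)" using V(1) f by (rule irreducible_in_image)
      moreover have "W \<subseteq> f ` V" using V(2) fgV(1)[OF W(2)] by blast
      ultimately have "f ` V = W" using V(3) W(3) by blast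
      then show ?thesis using gfV[OF V(3)] by simp
    qed
    ultimately have "g ` W \<in> irr_components T S" using fgV(2)[OF W(2)] by (simp add: irr_components_def)
    then show "W \<in> (`) f ` irr_components T S" using fgV(1)[OF W(2)] by (metis imageI)
  next
    fix W assume "W \<in> (`) f ` irr_components T S"
    then obtain V where V: "V \<in> irr_components T S" "W = f ` V" by blast
    note V_comp = irr_componentsD[OF V(1)]
    have "irreducible_in T' W" unfolding V(2) using V_comp(1) f by (rule irreducible_in_image)
    moreover have "V' = W" if V': "irreducible_in T' V'" "W \<subseteq> V'" "V' \<subseteq> f ` S" for V'
    proof -
      have "irreducible_in T (g ` V')" using V'(1) g by (rule irreducible_in_image)
      moreover have "V \<subseteq> g ` V'" using V'(2) V(2) gfV[OF V_comp(2)] by blast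
      ultimately have "g ` V' = V" using fgV(2)[OF V'(3)] V_comp(3) by blast
      then show ?thesis using fgV(1)[OF V'(3)] V(2) by simp
    qed
    ultimately show "W \<in> irr_components T' (f ` S)" using V V_comp(2) by (auto simp: irr_components_def)
  }
qed

text \<open>Noetherian induction over closed sets \<open>A\<close> writes
  \<open>S \<inter> A\<close> as a finite union of irreducible traces. Traces are used because
  \<open>S\<close> need not be closed: cycles are closed only in \<open>diamond Y n\<close>.\<close>

lemma finite_irr_components:
  assumes wf: "wf {(A, B). closedin T A \<and> closedin T B \<and> A \<subset> B}" and S: "S \<subseteq> topspace T"
  shows "finite (irr_components T S)"
proof -
  have "\<exists>\<C>. finite \<C> \<and> (\<forall>C\<in>\<C>. closedin T C \<and> irreducible_in T (S \<inter> C)) \<and> S \<inter> A = S \<inter> \<Union>\<C>"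
    if "closedin T A" for A
    using wf that
  proof (induction A rule: wf_induct_rule)
    case (less A)
    consider "S \<inter> A = {}" | "irreducible_in T (S \<inter> A)"
      | B C where "closedin T B" "closedin T C" "S \<inter> A \<subseteq> B \<union> C" "\<not> S \<inter> A \<subseteq> B" "\<not> S \<inter> A \<subseteq> C"
      using S unfolding irreducible_in_def by blast
    then show ?case
    proof cases
      case 1
      then show ?thesis by (intro exI[of _ "{}"]) auto
    next
      case 2
      then show ?thesis using less.prems by (intro exI[of _ "{A}"]) auto
    next
      case 3
      then have "closedin T (A \<inter> B)" "A \<inter> B \<subset> A" "closedin T (A \<inter> C)" "A \<inter> C \<subset> A"
        using less.prems by auto
      then obtain \<B> \<C> where
        "finite \<B>" "\<forall>C\<in>\<B>. closedin T C \<and> irreducible_in T (S \<inter> C)" "S \<inter> (A \<inter> B) = S \<inter> \<Union>\<B>"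
        "finite \<C>" "\<forall>C\<in>\<C>. closedin T C \<and> irreducible_in T (S \<inter> C)" "S \<inter> (A \<inter> C) = S \<inter> \<Union>\<C>"
        using less.IH[of "A \<inter> B"] less.IH[of "A \<inter> C"] less.prems by auto
      moreover from this 3 have "S \<inter> A = S \<inter> \<Union>(\<B> \<union> \<C>)" by blast
      ultimately show ?thesis by (intro exI[of _ "\<B> \<union> \<C>"]) auto
    qed
  qed
  from this[OF closedin_topspace] obtain \<C> where \<C>: "finite \<C>"
    "\<And>C. C \<in> \<C> \<Longrightarrow> closedin T C \<and> irreducible_in T (S \<inter> C)" "S \<inter> topspace T = S \<inter> \<Union>\<C>"
    by metis
  \<comment> \<open>A component lies in one of the finitely many covering sets and, by maximality,
    equals its trace on \<open>S\<close>.\<close>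
  have "irr_components T S \<subseteq> (\<lambda>C. S \<inter> C) ` \<C>"
  proof
    fix W assume "W \<in> irr_components T S"
    note W = irr_componentsD[OF this]
    obtain C where C: "C \<in> \<C>" "W \<subseteq> C"
      using irreducible_in_finite_cover[OF W(1) \<C>(1)] \<C>(2,3) W(2) S by blast
    with W(2,3) \<C>(2) have "S \<inter> C = W" by blast
    with C show "W \<in> (\<lambda>C. S \<inter> C) ` \<C>" by blast
  qed
  with \<C>(1) show ?thesis by (rule finite_surj)
qed

section \<open>Forms\<close>

text \<open>A map of points need not respect the chosen representatives of homogeneous coordinates;
  \<open>\<mu>\<close> is the resulting scale factor. The product rule of \<open>mform\<close>
  demands that \<open>\<delta>\<close> be additive and \<open>\<mu>\<close> multiplicative in the
  degree.\<close>

lemma mform_subst: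
  assumes "mform G' d F"
    and gen: "\<And>d f. (d, f) \<in> G' \<Longrightarrow> mform G (\<delta> d) (\<lambda>P. \<mu> d P * f (\<psi> P))"
    and \<delta>: "\<delta> (\<lambda>_. 0) = (\<lambda>_. 0)" "\<And>d e. \<delta> (\<lambda>i. d i + e i) = (\<lambda>i. \<delta> d i + \<delta> e i)"
    and \<mu>: "\<And>P. \<mu> (\<lambda>_. 0) P = 1" "\<And>d e P. \<mu> (\<lambda>i. d i + e i) P = \<mu> d P * \<mu> e P"
  shows "mform G (\<delta> d) (\<lambda>P. \<mu> d P * F (\<psi> P))"
  using assms(1)
proof induction
  case (const c)
  show ?case unfolding \<delta> \<mu> mult_1 by (rule mform.const)
next
  case (add d F F')
  then show ?case unfolding distrib_left by (intro mform.add)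
next
  case (mult d F e F')
  have "(\<lambda>P. \<mu> (\<lambda>i. d i + e i) P * (F (\<psi> P) * F' (\<psi> P))) = (\<lambda>P. \<mu> d P * F (\<psi> P) * (\<mu> e P * F' (\<psi> P)))"
    by (simp add: \<mu> ac_simps)
  then show ?case unfolding \<delta> using mult by (simp add: mform.mult)
qed (rule gen)

lemma mform_diff:
  assumes "mform G d F" "mform G d F'"
  shows "mform G d (\<lambda>P. F P - F' P)"
proof -
  have "mform G d (\<lambda>P. to_ac (- 1) * F' P)"
    using mform.mult[OF mform.const[of G "- 1"] assms(2)] by simp
  from mform.add[OF assms(1) this] show ?thesis by simp
qed

lemma mform_cross_diff:
  assumes "mform G d F" "mform G d H" "mform G e F'" "mform G e H'"
  shows "mform G (\<lambda>i. d i + e i) (\<lambda>P. F P * H' P - F' P * H P)"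
  using mform_diff[OF mform.mult[OF assms(1,4)] mform.mult[OF assms(2,3)]] by (simp add: mult.commute)

section \<open>Basic open sets, continuity and the Noetherian property of the Zariski
  topology\<close>

lemma openin_zariski_mform: "mform G d F \<Longrightarrow> openin (zariski S G) {P \<in> S. F P \<noteq> 0}"
  by (auto simp: zariski_def intro: topology_generated_by_Basis)

lemma topspace_zariski [simp]: "topspace (zariski S G) = S"
proof -
  have "{P \<in> S. to_ac 1 \<noteq> (0 :: 'b alg_closure)} = S" by simp
  then have "openin (zariski S G) S"
    using openin_zariski_mform[OF mform.const[of G 1], of S] by simp
  then have "S \<subseteq> topspace (zariski S G)" by (rule openin_subset)
  moreover have "topspace (zariski S G) \<subseteq> S"
    unfolding zariski_def topology_generated_by_topspace by auto
  ultimately show ?thesis by (rule antisym[rotated])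
qed

text \<open>The generating sets form a basis and not only a subbasis, because a product of forms is
  a form.\<close>

lemma openin_zariskiD:
  assumes "openin (zariski S G) U" "P \<in> U"
  obtains d F where "mform G d F" "F P \<noteq> 0" "{Q \<in> S. F Q \<noteq> 0} \<subseteq> U"
proof -
  have "generate_topology_on {{P \<in> S. F P \<noteq> 0} | F. \<exists>d. mform G d F} U"
    using assms(1) by (simp add: zariski_def openin_topology_generated_by_iff)
  then have "\<forall>P\<in>U. \<exists>d F. mform G d F \<and> F P \<noteq> 0 \<and> {Q \<in> S. F Q \<noteq> 0} \<subseteq> U"
  proof induction
    case (Int U V)
    show ?case
    proof
      fix P assume "P \<in> U \<inter> V"
      then have P: "P \<in> U" "P \<in> V" by auto
      obtain d F where "mform G d F" "F P \<noteq> 0" "{Q \<in> S. F Q \<noteq> 0} \<subseteq> U"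
        using bspec[OF Int.IH(1) P(1)] by blast
      moreover obtain e H where "mform G e H" "H P \<noteq> 0" "{Q \<in> S. H Q \<noteq> 0} \<subseteq> V"
        using bspec[OF Int.IH(2) P(2)] by blast
      ultimately show "\<exists>d F. mform G d F \<and> F P \<noteq> 0 \<and> {Q \<in> S. F Q \<noteq> 0} \<subseteq> U \<inter> V"
        using mform.mult[of G d F e H] by (intro exI conjI) (assumption, auto)
    qed
  next
    case (UN \<U>)
    show ?case
    proof
      fix P assume "P \<in> \<Union>\<U>"
      then obtain U where U: "U \<in> \<U>" "P \<in> U" by blast
      from bspec[OF UN.IH[OF U(1)] U(2)] U(1)
      show "\<exists>d F. mform G d F \<and> F P \<noteq> 0 \<and> {Q \<in> S. F Q \<noteq> 0} \<subseteq> \<Union>\<U>" by blast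
    qed
  qed auto
  from bspec[OF this assms(2)] show ?thesis using that by blast
qed

lemma closedin_zariski_mform: "mform G d F \<Longrightarrow> closedin (zariski S G) {P \<in> S. F P = 0}"
proof -
  assume "mform G d F"
  moreover have "S - {P \<in> S. F P = 0} = {P \<in> S. F P \<noteq> 0}" by blast
  ultimately show ?thesis by (auto simp: closedin_def openin_zariski_mform)
qed

text \<open>Comparing nonvanishing loci instead of values leaves room for scale factors without
  zeros.\<close>

lemma continuous_map_zariski:
  assumes "\<And>P. P \<in> S \<Longrightarrow> \<phi> P \<in> S'"
    and "\<And>d F. mform G' d F \<Longrightarrow> \<exists>e H. mform G e H \<and> (\<forall>P\<in>S. H P \<noteq> 0 \<longleftrightarrow> F (\<phi> P) \<noteq> 0)"
  shows "continuous_map (zariski S G) (zariski S' G') \<phi>"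
  unfolding continuous_map_def
proof (intro conjI allI impI)
  show "\<phi> \<in> topspace (zariski S G) \<rightarrow> topspace (zariski S' G')" using assms(1) by simp
  fix U assume U: "openin (zariski S' G') U"
  show "openin (zariski S G) {P \<in> topspace (zariski S G). \<phi> P \<in> U}"
  proof (subst openin_subopen, intro ballI)
    fix P assume "P \<in> {P \<in> topspace (zariski S G). \<phi> P \<in> U}"
    then have P: "P \<in> S" "\<phi> P \<in> U" by auto
    from openin_zariskiD[OF U P(2)] obtain d F where
      F: "mform G' d F" "F (\<phi> P) \<noteq> 0" "{Q \<in> S'. F Q \<noteq> 0} \<subseteq> U" .
    obtain e H where H: "mform G e H" "\<forall>P\<in>S. H P \<noteq> 0 \<longleftrightarrow> F (\<phi> P) \<noteq> 0" using assms(2)[OF F(1)] by blast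
    have "openin (zariski S G) {Q \<in> S. H Q \<noteq> 0}" using H(1) by (rule openin_zariski_mform)
    moreover have "P \<in> {Q \<in> S. H Q \<noteq> 0}" using H(2) F(2) P(1) by blast
    moreover have "{Q \<in> S. H Q \<noteq> 0} \<subseteq> {P \<in> topspace (zariski S G). \<phi> P \<in> U}"
      using H(2) F(3) assms(1) by auto
    ultimately show "\<exists>V. openin (zariski S G) V \<and> P \<in> V \<and>
        V \<subseteq> {P \<in> topspace (zariski S G). \<phi> P \<in> U}" by blast
  qed
qed

text \<open>In a strictly descending chain choose forms \<open>F i\<close> that vanish on
  \<open>C (Suc i)\<close> but not at a point \<open>P i\<close> of \<open>C i\<close>. Some
  \<open>F n\<close> lies in the ideal of its predecessors; these all vanish at \<open>P n\<close>,
  hence so does \<open>F n\<close>.\<close>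

lemma zariski_noetherian:
  fixes G :: "((nat \<Rightarrow> nat) \<times> ('p \<Rightarrow> 'k::field alg_closure)) set"
  assumes "finite G"
  shows "wf {(A, B). closedin (zariski S G) A \<and> closedin (zariski S G) B \<and> A \<subset> B}"
proof (rule ccontr)
  let ?T = "zariski S G"
  assume "\<not> wf {(A, B). closedin ?T A \<and> closedin ?T B \<and> A \<subset> B}"
  then obtain C where "\<forall>i. (C (Suc i), C i) \<in> {(A, B). closedin ?T A \<and> closedin ?T B \<and> A \<subset> B}"
    unfolding wf_iff_no_infinite_down_chain by meson
  then have C: "\<And>i. closedin ?T (C i)" "\<And>i. C (Suc i) \<subset> C i" by auto
  have "\<exists>F P. (\<exists>d. mform G d F) \<and> P \<in> C i \<and> F P \<noteq> 0 \<and> (\<forall>Q\<in>C (Suc i). F Q = 0)" for i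
  proof -
    obtain P where P: "P \<in> C i" "P \<notin> C (Suc i)" using C(2) by blast
    then have PS: "P \<in> topspace ?T - C (Suc i)" using closedin_subset[OF C(1)[of i]] by auto
    have "openin ?T (topspace ?T - C (Suc i))" using C(1) by blast
    from openin_zariskiD[OF this PS] obtain d F where
      F: "mform G d F" "F P \<noteq> 0" "{Q \<in> S. F Q \<noteq> 0} \<subseteq> topspace ?T - C (Suc i)" .
    then have "\<forall>Q\<in>C (Suc i). F Q = 0" using closedin_subset[OF C(1)[of "Suc i"]] by auto
    with F P show ?thesis by blast
  qed
  then obtain F P where FP: "\<And>i. \<exists>d. mform G d (F i)" "\<And>i. P i \<in> C i" "\<And>i. F i (P i) \<noteq> 0"
    "\<And>i Q. Q \<in> C (Suc i) \<Longrightarrow> F i Q = 0"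
    by metis
  obtain R where R: "noetherian_set R" "\<And>d F. mform G d F \<Longrightarrow> F \<in> R"
    using mform_subset_noetherian[OF assms] by metis
  have "range F \<subseteq> R" using FP(1) R(2) by blast
  then obtain n where n: "F n \<in> ideal_hull R (F ` {..<n})" using R(1) unfolding noetherian_set_def by meson
  have anti: "C j \<subseteq> C i" if "i \<le> j" for i j
    using lift_Suc_antimono_le[of C i j] C(2) that by blast
  have vanish: "F i (P n) = 0" if "i < n" for i
    using FP(2)[of n] FP(4) anti[of "Suc i" n] that by (meson Suc_leI subsetD)
  have "a (P n) = 0" if "a \<in> ideal_hull R (F ` {..<n})" for a
    using that by induction (use vanish in auto)
  with n FP(3) show False by blast
qed

text \<open>The zero loci of the two forms are closed and cover \<open>Z\<close>. This takes the
  place of the coordinate ring being a domain.\<close>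

lemma irreducible_zariski_mult_zero:
  assumes "irreducible_in (zariski S G) Z" "mform G d F" "mform G e H" "\<And>P. P \<in> Z \<Longrightarrow> F P * H P = 0"
  shows "(\<forall>P\<in>Z. F P = 0) \<or> (\<forall>P\<in>Z. H P = 0)"
proof -
  have "Z \<subseteq> S" using assms(1) by (simp add: irreducible_in_def)
  then have "Z \<subseteq> {P \<in> S. F P = 0} \<union> {P \<in> S. H P = 0}" using assms(4) by auto
  then have "Z \<subseteq> {P \<in> S. F P = 0} \<or> Z \<subseteq> {P \<in> S. H P = 0}"
    using assms(1) closedin_zariski_mform[OF assms(2)] closedin_zariski_mform[OF assms(3)]
    unfolding irreducible_in_def by meson
  then show ?thesis by blast
qed

lemma mform_zero_on_closure:
  assumes "mform G d F" "\<And>P. P \<in> A \<Longrightarrow> F P = 0" "A \<subseteq> S" "P \<in> zariski S G closure_of A"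
  shows "F P = 0"
  using closure_of_minimal[OF _ closedin_zariski_mform[OF assms(1)], of A S] assms(2-4) by blast


section \<open>Local rings\<close>

lemma ring_iso_ideal_image:
  assumes h: "h \<in> ring_iso R R'" "h \<zero>\<^bsub>R\<^esub> = \<zero>\<^bsub>R'\<^esub>" and J: "ideal J R"
  shows "ideal (h ` J) R'"
proof -
  interpret ideal J R by fact
  \<comment> \<open>\<open>ring_iso\<close> does not constrain the zero of the target, so the image
    structure is a ring whose zero is the image of zero; the second assumption identifies it with
    the zero of \<open>R'\<close>.\<close>
  have "ring (R'\<lparr>zero := h \<zero>\<^bsub>R\<^esub>\<rparr>)" using h(1) by (rule ring_iso_imp_img_ring)
  then have R': "ring R'" using h(2) by simp
  have hom: "h \<in> ring_hom R R'" and surj: "h ` carrier R = carrier R'"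
    using h(1) by (auto simp: ring_iso_def bij_betw_def)
  interpret h: ring_hom_ring R R' h using ring_hom_ringI2[OF ring_axioms R' hom] .
  interpret a: group_hom "add_monoid R" "add_monoid R'" h by (rule h.a_group_hom)
  have "subgroup (h ` J) (add_monoid R')"
    using a.subgroup_img_is_subgroup additive_subgroup.a_subgroup[OF is_additive_subgroup] by blast
  then show ?thesis
  proof (rule idealI[OF R'])
    fix a x assume "a \<in> h ` J" "x \<in> carrier R'"
    then obtain b y where b: "b \<in> J" "a = h b" and y: "y \<in> carrier R" "x = h y" using surj by blast
    have "x \<otimes>\<^bsub>R'\<^esub> a = h (y \<otimes>\<^bsub>R\<^esub> b)" "a \<otimes>\<^bsub>R'\<^esub> x = h (b \<otimes>\<^bsub>R\<^esub> y)" using b y Icarr by simp_all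
    then show "x \<otimes>\<^bsub>R'\<^esub> a \<in> h ` J" "a \<otimes>\<^bsub>R'\<^esub> x \<in> h ` J"
      using I_l_closed[OF b(1) y(1)] I_r_closed[OF b(1) y(1)] by auto
  qed
qed

lemma ideal_chain_image:
  assumes h: "h \<in> ring_iso R R'" "h \<zero>\<^bsub>R\<^esub> = \<zero>\<^bsub>R'\<^esub>"
    and J: "\<forall>i\<le>l. ideal (J i) R \<and> I \<subseteq> J i" "\<forall>i<l. J i \<subset> J (Suc i)"
  shows "\<exists>J'. (\<forall>i\<le>l. ideal (J' i) R' \<and> h ` I \<subseteq> J' i) \<and> (\<forall>i<l. J' i \<subset> J' (Suc i))"
proof (intro exI[of _ "\<lambda>i. h ` J i"] conjI allI impI)
  fix i assume "i \<le> l"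
  then show "ideal (h ` J i) R'" "h ` I \<subseteq> h ` J i"
    using ring_iso_ideal_image[OF h] J(1) by auto
next
  fix i assume i: "i < l"
  have "inj_on h (carrier R)" using h(1) by (auto simp: ring_iso_def bij_betw_def)
  moreover have "J i \<subset> J (Suc i)" "J (Suc i) \<subseteq> carrier R"
    using J i by (auto dest!: spec[of _ "Suc i"] ideal.Icarr)
  ultimately show "h ` J i \<subset> h ` J (Suc i)"
    using inj_on_image_eq_iff[of h "carrier R" "J i" "J (Suc i)"] by blast
qed

text \<open>Strict chains of ideals are carried to strict chains in both directions. For
  \<open>R\<close> only closure under the operations is asked, since the ring axioms come with every
  \<open>ideal\<close> in a chain.\<close>

lemma quot_length_iso:
  assumes h: "h \<in> ring_iso R R'" "h \<zero>\<^bsub>R\<^esub> = \<zero>\<^bsub>R'\<^esub>" and I: "I \<subseteq> carrier R"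
    and closed: "\<zero>\<^bsub>R\<^esub> \<in> carrier R" "\<one>\<^bsub>R\<^esub> \<in> carrier R"
      "\<And>a b. a \<in> carrier R \<Longrightarrow> b \<in> carrier R \<Longrightarrow> a \<otimes>\<^bsub>R\<^esub> b \<in> carrier R \<and> a \<oplus>\<^bsub>R\<^esub> b \<in> carrier R"
  shows "quot_length R' (h ` I) = quot_length R I"
proof -
  define g where "g = inv_into (carrier R) h"
  have bij: "bij_betw h (carrier R) (carrier R')" using h(1) by (simp add: ring_iso_def)
  have gh: "g (h x) = x" if "x \<in> carrier R" for x
    using bij that by (simp add: g_def bij_betw_def)
  have surj: "\<exists>x\<in>carrier R. y = h x" if "y \<in> carrier R'" for y
    using bij that by (auto simp: bij_betw_def)
  have "g \<in> ring_iso R' R"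
  proof (rule ring_iso_memI)
    show "bij_betw g (carrier R') (carrier R)" unfolding g_def using bij by (rule bij_betw_inv_into)
    then show "g x \<in> carrier R" if "x \<in> carrier R'" for x using that by (rule bij_betwE[rule_format])
    show "g \<one>\<^bsub>R'\<^esub> = \<one>\<^bsub>R\<^esub>" using gh[OF closed(2)] ring_iso_memE(4)[OF h(1)] by simp
    fix x y assume "x \<in> carrier R'" "y \<in> carrier R'"
    then obtain a b where ab: "a \<in> carrier R" "x = h a" "b \<in> carrier R" "y = h b" using surj by blast
    then have "x \<otimes>\<^bsub>R'\<^esub> y = h (a \<otimes>\<^bsub>R\<^esub> b)" "x \<oplus>\<^bsub>R'\<^esub> y = h (a \<oplus>\<^bsub>R\<^esub> b)"
      using ring_iso_memE(2,3)[OF h(1)] by simp_all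
    then show "g (x \<otimes>\<^bsub>R'\<^esub> y) = g x \<otimes>\<^bsub>R\<^esub> g y" "g (x \<oplus>\<^bsub>R'\<^esub> y) = g x \<oplus>\<^bsub>R\<^esub> g y"
      using gh closed(3) ab by simp_all
  qed
  moreover have "g \<zero>\<^bsub>R'\<^esub> = \<zero>\<^bsub>R\<^esub>" using gh[OF closed(1)] h(2) by simp
  moreover have "g ` h ` I = I"
    unfolding image_image using gh I by (intro trans[OF image_cong[OF refl] image_ident]) blast
  ultimately have g: "g \<in> ring_iso R' R" "g \<zero>\<^bsub>R'\<^esub> = \<zero>\<^bsub>R\<^esub>" "g ` h ` I = I" by blast+
  have "(\<exists>J. (\<forall>i\<le>l. ideal (J i) R' \<and> h ` I \<subseteq> J i) \<and> (\<forall>i<l. J i \<subset> J (Suc i))) \<longleftrightarrow>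
        (\<exists>J. (\<forall>i\<le>l. ideal (J i) R \<and> I \<subseteq> J i) \<and> (\<forall>i<l. J i \<subset> J (Suc i)))" for l
  proof (intro iffI; elim exE conjE)
    fix J assume "\<forall>i\<le>l. ideal (J i) R' \<and> h ` I \<subseteq> J i" "\<forall>i<l. J i \<subset> J (Suc i)"
    from ideal_chain_image[OF g(1,2) this]
    show "\<exists>J. (\<forall>i\<le>l. ideal (J i) R \<and> I \<subseteq> J i) \<and> (\<forall>i<l. J i \<subset> J (Suc i))" by (simp only: g(3))
  next
    fix J assume "\<forall>i\<le>l. ideal (J i) R \<and> I \<subseteq> J i" "\<forall>i<l. J i \<subset> J (Suc i)"
    from ideal_chain_image[OF h this]
    show "\<exists>J. (\<forall>i\<le>l. ideal (J i) R' \<and> h ` I \<subseteq> J i) \<and> (\<forall>i<l. J i \<subset> J (Suc i))" .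
  qed
  then show ?thesis by (simp add: quot_length_def)
qed

section \<open>Fractions of forms on an irreducible set\<close>

lemma frac_rel_iff:
  "((F, H), (F', H')) \<in> frac_rel G Z \<longleftrightarrow>
     (F, H) \<in> fracs G Z \<and> (F', H') \<in> fracs G Z \<and> (\<forall>P\<in>Z. F P * H' P = F' P * H P)"
  by (simp add: frac_rel_def)

lemma mem_ratio_iff:
  "(F', H') \<in> ratio G Z F H \<longleftrightarrow>
     (F, H) \<in> fracs G Z \<and> (F', H') \<in> fracs G Z \<and> (\<forall>P\<in>Z. F P * H' P = F' P * H P)"
  by (simp add: ratio_def frac_rel_iff)

locale irreducible_forms =
  fixes S :: "'p set" and G :: "((nat \<Rightarrow> nat) \<times> ('p \<Rightarrow> 'k::field alg_closure)) set" and Z :: "'p set"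
  assumes irreducible: "irreducible_in (zariski S G) Z"
begin

lemma nonzero_mult:
  assumes "mform G d F" "mform G e H" "\<exists>P\<in>Z. F P \<noteq> 0" "\<exists>P\<in>Z. H P \<noteq> 0"
  shows "\<exists>P\<in>Z. F P * H P \<noteq> 0"
  using irreducible_zariski_mult_zero[OF irreducible assms(1,2)] assms(3,4) by blast

text \<open>Irreducibility enters in transitivity: the third relation is obtained multiplied by the
  middle denominator, which can be cancelled because it does not vanish identically on
  \<open>Z\<close>.\<close>

lemma equiv_frac_rel: "equiv (fracs G Z) (frac_rel G Z)"
proof (rule equivI)
  show "frac_rel G Z \<subseteq> fracs G Z \<times> fracs G Z" by (auto simp: frac_rel_def)
  show "refl_on (fracs G Z) (frac_rel G Z)" by (auto simp: refl_on_def frac_rel_iff)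
  show "sym (frac_rel G Z)" by (auto simp: sym_def frac_rel_iff)
  show "trans (frac_rel G Z)"
  proof (rule transI, clarify)
    fix F H F' H' F'' H''
    assume "((F, H), (F', H')) \<in> frac_rel G Z" "((F', H'), (F'', H'')) \<in> frac_rel G Z"
    then have fr: "(F, H) \<in> fracs G Z" "(F', H') \<in> fracs G Z" "(F'', H'') \<in> fracs G Z"
      and eq: "\<And>P. P \<in> Z \<Longrightarrow> F P * H' P = F' P * H P" "\<And>P. P \<in> Z \<Longrightarrow> F' P * H'' P = F'' P * H' P"
      by (auto simp: frac_rel_iff)
    obtain d e f where f: "mform G d F" "mform G d H" "mform G e H'" "mform G f F''" "mform G f H''"
      and nz: "\<exists>P\<in>Z. H' P \<noteq> 0"
      using fr by (auto simp: fracs_def)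
    have "H' P * (F P * H'' P - F'' P * H P) = 0" if "P \<in> Z" for P
    proof -
      have "H' P * (F P * H'' P - F'' P * H P) = (F P * H' P) * H'' P - (F'' P * H' P) * H P"
        by (simp add: algebra_simps)
      also have "\<dots> = 0" using eq[OF that] by (simp flip: eq(2)[OF that])
      finally show ?thesis .
    qed
    then have "\<forall>P\<in>Z. F P * H'' P - F'' P * H P = 0"
      using irreducible_zariski_mult_zero[OF irreducible f(3) mform_cross_diff[OF f(1,2,4,5)]] nz by blast
    then show "((F, H), (F'', H'')) \<in> frac_rel G Z" using fr by (simp add: frac_rel_iff)
  qed
qed

lemma ratio_eq_iff:
  assumes "(F, H) \<in> fracs G Z" "(F', H') \<in> fracs G Z"
  shows "ratio G Z F H = ratio G Z F' H' \<longleftrightarrow> (\<forall>P\<in>Z. F P * H' P = F' P * H P)"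
  unfolding ratio_def using eq_equiv_class_iff[OF equiv_frac_rel assms] assms
  by (simp add: frac_rel_iff)

text \<open>The operations of \<open>function_field\<close> are unions over representatives; if all
  of them give the same class, the union is that class.\<close>

lemma ratio_UN:
  assumes "(F, H) \<in> fracs G Z"
    and "\<And>F' H'. (F', H') \<in> fracs G Z \<Longrightarrow> \<forall>P\<in>Z. F P * H' P = F' P * H P \<Longrightarrow> k F' H' = k F H"
  shows "(\<Union>(F', H')\<in>ratio G Z F H. k F' H') = k F H"
proof -
  have "(\<Union>(F', H')\<in>ratio G Z F H. k F' H') = (\<Union>_\<in>ratio G Z F H. k F H)"
  proof (rule SUP_cong[OF refl], clarify)
    fix F' H' assume "(F', H') \<in> ratio G Z F H"
    then have "(F', H') \<in> fracs G Z" "\<forall>P\<in>Z. F P * H' P = F' P * H P" by (simp_all add: mem_ratio_iff)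
    then show "k F' H' = k F H" by (rule assms(2))
  qed
  moreover have "(F, H) \<in> ratio G Z F H" using assms(1) by (simp add: mem_ratio_iff)
  ultimately show ?thesis by (simp only: UN_constant split: if_split) blast
qed

lemma fracs_mult:
  assumes "(F, H) \<in> fracs G Z" "(F', H') \<in> fracs G Z"
  shows "(\<lambda>P. F P * F' P, \<lambda>P. H P * H' P) \<in> fracs G Z"
proof -
  obtain d e where f: "mform G d F" "mform G d H" "mform G e F'" "mform G e H'"
    and nz: "\<exists>P\<in>Z. H P \<noteq> 0" "\<exists>P\<in>Z. H' P \<noteq> 0"
    using assms by (auto simp: fracs_def)
  show ?thesis
    using mform.mult[OF f(1,3)] mform.mult[OF f(2,4)] nonzero_mult[OF f(2,4) nz]
    unfolding fracs_def by blast
qed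

lemma fracs_add:
  assumes "(F, H) \<in> fracs G Z" "(F', H') \<in> fracs G Z"
  shows "(\<lambda>P. F P * H' P + F' P * H P, \<lambda>P. H P * H' P) \<in> fracs G Z"
proof -
  obtain d e where f: "mform G d F" "mform G d H" "mform G e F'" "mform G e H'"
    using assms by (auto simp: fracs_def)
  have "mform G (\<lambda>i. d i + e i) (\<lambda>P. F' P * H P)"
    using mform.mult[OF f(2,3)] by (simp add: mult.commute)
  from mform.add[OF mform.mult[OF f(1,4)] this] mform.mult[OF f(2,4)] fracs_mult[OF assms]
  show ?thesis by (auto simp: fracs_def)
qed

lemma ratio_mult:
  assumes FH: "(F, H) \<in> fracs G Z" "(F', H') \<in> fracs G Z"
  shows "ratio G Z F H \<otimes>\<^bsub>function_field G Z\<^esub> ratio G Z F' H' =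
         ratio G Z (\<lambda>P. F P * F' P) (\<lambda>P. H P * H' P)"
proof -
  have "ratio G Z (\<lambda>P. F1 P * F1' P) (\<lambda>P. H1 P * H1' P) = ratio G Z (\<lambda>P. F2 P * F2' P) (\<lambda>P. H2 P * H2' P)"
    if "(F1, H1) \<in> fracs G Z" "(F1', H1') \<in> fracs G Z" "(F2, H2) \<in> fracs G Z" "(F2', H2') \<in> fracs G Z"
      "\<forall>P\<in>Z. F1 P * H2 P = F2 P * H1 P" "\<forall>P\<in>Z. F1' P * H2' P = F2' P * H1' P"
    for F1 H1 F1' H1' F2 H2 F2' H2'
  proof (subst ratio_eq_iff[OF fracs_mult fracs_mult], fact+, intro ballI)
    fix P assume "P \<in> Z"
    then have "(F1 P * H2 P) * (F1' P * H2' P) = (F2 P * H1 P) * (F2' P * H1' P)" using that by simp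
    then show "F1 P * F1' P * (H2 P * H2' P) = F2 P * F2' P * (H1 P * H1' P)" by (simp add: mult_ac)
  qed
  note wd = this
  show ?thesis
    unfolding function_field_def monoid.simps ring.simps
    by (subst ratio_UN[OF FH(1)], subst (1 2) ratio_UN[OF FH(2)], (rule wd; use FH in simp)+,
        rule ratio_UN[OF FH(2)], rule wd; use FH in simp)
qed

lemma ratio_add:
  assumes FH: "(F, H) \<in> fracs G Z" "(F', H') \<in> fracs G Z"
  shows "ratio G Z F H \<oplus>\<^bsub>function_field G Z\<^esub> ratio G Z F' H' =
         ratio G Z (\<lambda>P. F P * H' P + F' P * H P) (\<lambda>P. H P * H' P)"
proof -
  have wd: "ratio G Z (\<lambda>P. F1 P * H1' P + F1' P * H1 P) (\<lambda>P. H1 P * H1' P) =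
        ratio G Z (\<lambda>P. F2 P * H2' P + F2' P * H2 P) (\<lambda>P. H2 P * H2' P)"
    if "(F1, H1) \<in> fracs G Z" "(F1', H1') \<in> fracs G Z" "(F2, H2) \<in> fracs G Z" "(F2', H2') \<in> fracs G Z"
      "\<forall>P\<in>Z. F1 P * H2 P = F2 P * H1 P" "\<forall>P\<in>Z. F1' P * H2' P = F2' P * H1' P"
    for F1 H1 F1' H1' F2 H2 F2' H2'
  proof (subst ratio_eq_iff[OF fracs_add fracs_add], fact+, intro ballI)
    fix P assume "P \<in> Z"
    then have eq: "F1 P * H2 P = F2 P * H1 P" "F1' P * H2' P = F2' P * H1' P" using that by auto
    have "(F1 P * H1' P + F1' P * H1 P) * (H2 P * H2' P) =
        (F1 P * H2 P) * (H1' P * H2' P) + (F1' P * H2' P) * (H1 P * H2 P)" by (simp add: algebra_simps)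
    also have "\<dots> = (F2 P * H2' P + F2' P * H2 P) * (H1 P * H1' P)"
      unfolding eq by (simp add: algebra_simps)
    finally show "(F1 P * H1' P + F1' P * H1 P) * (H2 P * H2' P) =
        (F2 P * H2' P + F2' P * H2 P) * (H1 P * H1' P)" .
  qed
  show ?thesis
    unfolding function_field_def monoid.simps ring.simps
    by (subst ratio_UN[OF FH(1)], subst (1 2) ratio_UN[OF FH(2)], (rule wd; use FH in simp)+,
        rule ratio_UN[OF FH(2)], rule wd; use FH in simp)
qed

lemma fracs_const:
  "mform G (\<lambda>_. 0) F \<Longrightarrow> (F, \<lambda>_. 1) \<in> fracs G Z"
  using irreducible mform.const[of G 1] by (auto simp: fracs_def irreducible_in_def)

lemma fracs_one: "(\<lambda>_. 1, \<lambda>_. 1) \<in> fracs G Z"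
  using fracs_const mform.const[of G 1] by simp

lemma fracs_zero: "(\<lambda>_. 0, \<lambda>_. 1) \<in> fracs G Z"
  using fracs_const mform.const[of G 0] by simp

end

section \<open>Local rings and their comparison along a map with dense image\<close>

abbreviation local_ring_at where
  "local_ring_at G Z W \<equiv> (function_field G Z)\<lparr>carrier := local_ring G Z W\<rparr>"

lemma mem_local_ring: "(F, H) \<in> fracs G Z \<Longrightarrow> \<exists>P\<in>W. H P \<noteq> 0 \<Longrightarrow> ratio G Z F H \<in> local_ring G Z W"
  unfolding local_ring_def by blast

lemma local_ringE:
  assumes "a \<in> local_ring G Z W"
  obtains F H where "a = ratio G Z F H" "(F, H) \<in> fracs G Z" "\<exists>P\<in>W. H P \<noteq> 0"
  using assms unfolding local_ring_def by blast

text \<open>In the application \<open>\<phi>\<close> forgets a coordinate. Forms pull back as they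
  are; in the other direction a form of degree \<open>d\<close> on \<open>Z'\<close> comes from one
  on \<open>Z\<close> after multiplication by \<open>\<mu> d\<close>, which has no zeros on
  \<open>Z'\<close>. Density of the image of \<open>W'\<close> in \<open>W\<close> ensures that a
  denominator not vanishing identically on \<open>W\<close> keeps this property on
  \<open>W'\<close>.\<close>

locale local_ring_comparison =
  Z: irreducible_forms S G Z + W: irreducible_forms S G W +
  Z': irreducible_forms S' G' Z' + W': irreducible_forms S' G' W'
  for S :: "'p set" and G :: "((nat \<Rightarrow> nat) \<times> ('p \<Rightarrow> 'k::field alg_closure)) set" and Z W
    and S' :: "'q set" and G' :: "((nat \<Rightarrow> nat) \<times> ('q \<Rightarrow> 'k alg_closure)) set" and Z' W' +
  fixes \<phi> :: "'q \<Rightarrow> 'p" and \<delta> \<epsilon> :: "(nat \<Rightarrow> nat) \<Rightarrow> nat \<Rightarrow> nat" and \<mu> :: "(nat \<Rightarrow> nat) \<Rightarrow> 'q \<Rightarrow> 'k alg_closure"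
  assumes pull: "mform G d F \<Longrightarrow> mform G' (\<delta> d) (\<lambda>P. F (\<phi> P))"
    and push: "mform G' d F' \<Longrightarrow> \<exists>F. mform G (\<epsilon> d) F \<and> (\<forall>P\<in>Z'. F (\<phi> P) = \<mu> d P * F' P)"
    and nonzero: "P \<in> Z' \<Longrightarrow> \<mu> d P \<noteq> 0"
    and maps: "\<phi> ` Z' \<subseteq> Z" "\<phi> ` W' \<subseteq> W" and sub: "W' \<subseteq> Z'"
    and dense: "Z \<subseteq> zariski S G closure_of (\<phi> ` Z')" "W \<subseteq> zariski S G closure_of (\<phi> ` W')"
begin

lemma subset_S: "\<phi> ` Z' \<subseteq> S" "\<phi> ` W' \<subseteq> S"
  using Z.irreducible maps sub by (auto simp: irreducible_in_def)

lemma nonzero_pull: "mform G d H \<Longrightarrow> \<exists>P\<in>Z. H P \<noteq> 0 \<Longrightarrow> \<exists>P\<in>Z'. H (\<phi> P) \<noteq> 0"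
  "mform G d H \<Longrightarrow> \<exists>P\<in>W. H P \<noteq> 0 \<Longrightarrow> \<exists>P\<in>W'. H (\<phi> P) \<noteq> 0"
  using mform_zero_on_closure[of G d H "\<phi> ` Z'" S] mform_zero_on_closure[of G d H "\<phi> ` W'" S]
    subset_S dense by blast+

lemma fracs_pull: "(F, H) \<in> fracs G Z \<Longrightarrow> (\<lambda>P. F (\<phi> P), \<lambda>P. H (\<phi> P)) \<in> fracs G' Z'"
proof -
  assume "(F, H) \<in> fracs G Z"
  then obtain d where f: "mform G d F" "mform G d H" and nz: "\<exists>P\<in>Z. H P \<noteq> 0" by (auto simp: fracs_def)
  from pull[OF f(1)] pull[OF f(2)] nonzero_pull(1)[OF f(2) nz]
  show ?thesis unfolding fracs_def by blast
qed

text \<open>The cross difference is itself a form, so by density it vanishes on \<open>Z\<close>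
  once its pullback vanishes on \<open>Z'\<close>. One direction makes \<open>pullback\<close> well
  defined, the other makes it injective.\<close>

lemma ratio_pull_eq_iff:
  assumes "(F, H) \<in> fracs G Z" "(F', H') \<in> fracs G Z"
  shows "ratio G' Z' (\<lambda>P. F (\<phi> P)) (\<lambda>P. H (\<phi> P)) = ratio G' Z' (\<lambda>P. F' (\<phi> P)) (\<lambda>P. H' (\<phi> P)) \<longleftrightarrow>
         ratio G Z F H = ratio G Z F' H'"
proof -
  obtain d e where f: "mform G d F" "mform G d H" "mform G e F'" "mform G e H'"
    using assms by (auto simp: fracs_def)
  have "(\<forall>P\<in>Z'. F (\<phi> P) * H' (\<phi> P) = F' (\<phi> P) * H (\<phi> P)) \<longleftrightarrow> (\<forall>P\<in>Z. F P * H' P = F' P * H P)"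
    using nonzero_pull(1)[OF mform_cross_diff[OF f]] maps(1) by auto
  then show ?thesis
    by (simp add: Z.ratio_eq_iff[OF assms] Z'.ratio_eq_iff[OF assms[THEN fracs_pull]])
qed

definition pullback where
  "pullback a = (\<Union>(F, H)\<in>a. ratio G' Z' (\<lambda>P. F (\<phi> P)) (\<lambda>P. H (\<phi> P)))"

lemma pullback_ratio:
  assumes "(F, H) \<in> fracs G Z"
  shows "pullback (ratio G Z F H) = ratio G' Z' (\<lambda>P. F (\<phi> P)) (\<lambda>P. H (\<phi> P))"
  unfolding pullback_def
  by (rule Z.ratio_UN[OF assms]) (use assms in \<open>simp add: ratio_pull_eq_iff Z.ratio_eq_iff\<close>)

lemma pullback_zero: "pullback \<zero>\<^bsub>local_ring_at G Z W\<^esub> = \<zero>\<^bsub>local_ring_at G' Z' W'\<^esub>"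
  using pullback_ratio[OF Z.fracs_zero] by (simp add: function_field_def)

text \<open>As \<open>W\<close> is irreducible, a product of two denominators is again nonzero
  somewhere on \<open>W\<close>.\<close>

lemma local_ring_closed:
  assumes "a \<in> local_ring G Z W" "b \<in> local_ring G Z W"
  shows "a \<otimes>\<^bsub>local_ring_at G Z W\<^esub> b \<in> local_ring G Z W" "a \<oplus>\<^bsub>local_ring_at G Z W\<^esub> b \<in> local_ring G Z W"
    and "pullback (a \<otimes>\<^bsub>local_ring_at G Z W\<^esub> b) = pullback a \<otimes>\<^bsub>local_ring_at G' Z' W'\<^esub> pullback b"
    and "pullback (a \<oplus>\<^bsub>local_ring_at G Z W\<^esub> b) = pullback a \<oplus>\<^bsub>local_ring_at G' Z' W'\<^esub> pullback b"
proof -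
  obtain F H where a: "a = ratio G Z F H" "(F, H) \<in> fracs G Z" "\<exists>P\<in>W. H P \<noteq> 0"
    using local_ringE[OF assms(1)] .
  obtain F' H' where b: "b = ratio G Z F' H'" "(F', H') \<in> fracs G Z" "\<exists>P\<in>W. H' P \<noteq> 0"
    using local_ringE[OF assms(2)] .
  obtain d e where "mform G d H" "mform G e H'" using a b by (auto simp: fracs_def)
  then have nz: "\<exists>P\<in>W. H P * H' P \<noteq> 0" using a(3) b(3) by (rule W.nonzero_mult)
  note ab = a(2) b(2) and ab' = a(2)[THEN fracs_pull] b(2)[THEN fracs_pull]
  show "a \<otimes>\<^bsub>local_ring_at G Z W\<^esub> b \<in> local_ring G Z W" "a \<oplus>\<^bsub>local_ring_at G Z W\<^esub> b \<in> local_ring G Z W"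
    using nz ab by (simp_all add: a(1) b(1) Z.ratio_mult Z.ratio_add mem_local_ring Z.fracs_mult Z.fracs_add)
  show "pullback (a \<otimes>\<^bsub>local_ring_at G Z W\<^esub> b) = pullback a \<otimes>\<^bsub>local_ring_at G' Z' W'\<^esub> pullback b"
    "pullback (a \<oplus>\<^bsub>local_ring_at G Z W\<^esub> b) = pullback a \<oplus>\<^bsub>local_ring_at G' Z' W'\<^esub> pullback b"
    by (simp_all add: a(1) b(1) Z.ratio_mult[OF ab] Z.ratio_add[OF ab] pullback_ratio[OF ab(1)] pullback_ratio[OF ab(2)]
        pullback_ratio[OF Z.fracs_mult[OF ab]] pullback_ratio[OF Z.fracs_add[OF ab]] Z'.ratio_mult[OF ab'] Z'.ratio_add[OF ab'])
qed

lemma pullback_ring_iso: "pullback \<in> ring_iso (local_ring_at G Z W) (local_ring_at G' Z' W')"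
proof (rule ring_iso_memI)
  have in_local: "pullback a \<in> local_ring G' Z' W'" if a_in: "a \<in> local_ring G Z W" for a
  proof -
    obtain F H where a: "a = ratio G Z F H" "(F, H) \<in> fracs G Z" "\<exists>P\<in>W. H P \<noteq> 0"
      using local_ringE[OF a_in] .
    obtain d where "mform G d H" using a by (auto simp: fracs_def)
    with a show ?thesis by (simp add: pullback_ratio mem_local_ring fracs_pull nonzero_pull(2))
  qed
  show "pullback \<one>\<^bsub>local_ring_at G Z W\<^esub> = \<one>\<^bsub>local_ring_at G' Z' W'\<^esub>"
    using pullback_ratio[OF Z.fracs_one] by (simp add: function_field_def)
  have "inj_on pullback (local_ring G Z W)"
  proof (rule inj_onI)
    fix a b assume "a \<in> local_ring G Z W" "b \<in> local_ring G Z W" and eq: "pullback a = pullback b"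
    then obtain F H F' H' where "a = ratio G Z F H" "(F, H) \<in> fracs G Z"
      "b = ratio G Z F' H'" "(F', H') \<in> fracs G Z" by (metis local_ringE)
    with eq show "a = b" by (simp add: pullback_ratio ratio_pull_eq_iff)
  qed
  \<comment> \<open>Numerator and denominator are pushed down separately; they acquire the same
    factor \<open>\<mu> d\<close> because they share the multidegree.\<close>
  moreover have "\<exists>a\<in>local_ring G Z W. b = pullback a" if b_in: "b \<in> local_ring G' Z' W'" for b
  proof -
    obtain F' H' where b: "b = ratio G' Z' F' H'" "(F', H') \<in> fracs G' Z'" "\<exists>P\<in>W'. H' P \<noteq> 0"
      using local_ringE[OF b_in] .
    then obtain d where d: "mform G' d F'" "mform G' d H'" by (auto simp: fracs_def)
    obtain F where F: "mform G (\<epsilon> d) F" "\<And>P. P \<in> Z' \<Longrightarrow> F (\<phi> P) = \<mu> d P * F' P"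
      using push[OF d(1)] by blast
    obtain H where H: "mform G (\<epsilon> d) H" "\<And>P. P \<in> Z' \<Longrightarrow> H (\<phi> P) = \<mu> d P * H' P"
      using push[OF d(2)] by blast
    obtain P where P: "P \<in> W'" "H' P \<noteq> 0" using b(3) by blast
    then have "P \<in> Z'" using sub by blast
    then have nz: "H (\<phi> P) \<noteq> 0" using H(2) P(2) nonzero by simp
    have in_W: "\<phi> P \<in> W" and in_Z: "\<phi> P \<in> Z" using P(1) \<open>P \<in> Z'\<close> maps by blast+
    have FH: "(F, H) \<in> fracs G Z" using F(1) H(1) nz in_Z unfolding fracs_def by blast
    have "b = pullback (ratio G Z F H)"
      using F(2) H(2) by (simp add: b(1) pullback_ratio[OF FH] Z'.ratio_eq_iff[OF b(2) fracs_pull[OF FH]])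
    moreover have "ratio G Z F H \<in> local_ring G Z W" using FH nz in_W by (blast intro: mem_local_ring)
    ultimately show ?thesis by blast
  qed
  ultimately show "bij_betw pullback (carrier (local_ring_at G Z W)) (carrier (local_ring_at G' Z' W'))"
    using in_local by (auto simp: bij_betw_def)
  show "pullback x \<in> carrier (local_ring_at G' Z' W')" if "x \<in> carrier (local_ring_at G Z W)" for x
    using that in_local by simp
qed (use local_ring_closed(3,4) in simp_all)

lemma quot_length_pullback:
  assumes FH: "(F, H) \<in> fracs G Z" "\<exists>P\<in>W. H P \<noteq> 0"
  shows "quot_length (local_ring_at G' Z' W')
           (PIdl\<^bsub>local_ring_at G' Z' W'\<^esub> ratio G' Z' (\<lambda>P. F (\<phi> P)) (\<lambda>P. H (\<phi> P))) =
         quot_length (local_ring_at G Z W) (PIdl\<^bsub>local_ring_at G Z W\<^esub> ratio G Z F H)"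
proof -
  let ?R = "local_ring_at G Z W" and ?R' = "local_ring_at G' Z' W'" and ?a = "ratio G Z F H"
  have a: "?a \<in> carrier ?R" using FH by (simp add: mem_local_ring)
  have surj: "pullback ` carrier ?R = carrier ?R'"
    using ring_iso_memE(5)[OF pullback_ring_iso] by (simp add: bij_betw_def)
  have "pullback ` (PIdl\<^bsub>?R\<^esub> ?a) = PIdl\<^bsub>?R'\<^esub> (pullback ?a)"
    unfolding cgenideal_def surj[symmetric] using ring_iso_memE(2)[OF pullback_ring_iso _ a] by fastforce
  moreover have "quot_length ?R' (pullback ` (PIdl\<^bsub>?R\<^esub> ?a)) = quot_length ?R (PIdl\<^bsub>?R\<^esub> ?a)"
  proof (rule quot_length_iso[OF pullback_ring_iso pullback_zero])
    show "PIdl\<^bsub>?R\<^esub> ?a \<subseteq> carrier ?R"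
      using local_ring_closed(1) a by (auto simp: cgenideal_def)
    have "\<exists>P\<in>W. (1 :: 'k alg_closure) \<noteq> 0" using W.irreducible by (auto simp: irreducible_in_def)
    then show "\<zero>\<^bsub>?R\<^esub> \<in> carrier ?R" "\<one>\<^bsub>?R\<^esub> \<in> carrier ?R"
      using mem_local_ring[OF Z.fracs_zero] mem_local_ring[OF Z.fracs_one] by (simp_all add: function_field_def)
  qed (use local_ring_closed in auto)
  ultimately show ?thesis by (simp add: pullback_ratio[OF FH(1)])
qed

end


section \<open>Inserting and forgetting coordinates\<close>

text \<open>Points are built from a coordinate function, numbered from 1 as in \<open>t_of\<close>,
  so that insertion and deletion are computed coordinatewise instead of on lists.\<close>

definition mk_pt :: "nat \<Rightarrow> (nat \<Rightarrow> 'k::field alg_closure) \<Rightarrow> 'k alg_closure \<Rightarrow>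
    (nat \<Rightarrow> 'k alg_closure option) \<Rightarrow> 'k pt" where
  "mk_pt n y x g = (y, x, map g [1..<Suc n])"

lemma mk_pt_simps [simp]:
  "fst (mk_pt n y x g) = y" "x_of (mk_pt n y x g) = x" "length (snd (snd (mk_pt n y x g))) = n"
  "i \<in> {1..n} \<Longrightarrow> t_of i (mk_pt n y x g) = g i"
  by (auto simp: mk_pt_def x_of_def t_of_def simp del: upt_Suc)

lemma pt_eqI:
  assumes "fst P = fst Q" "x_of P = x_of Q" "length (snd (snd P)) = n" "length (snd (snd Q)) = n"
    and "\<And>i. i \<in> {1..n} \<Longrightarrow> t_of i P = t_of i Q"
  shows "P = Q"
proof -
  have "snd (snd P) = snd (snd Q)"
  proof (rule nth_equalityI)
    fix i assume "i < length (snd (snd P))"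
    then show "snd (snd P) ! i = snd (snd Q) ! i" using assms(3) assms(5)[of "Suc i"] by (simp add: t_of_def)
  qed (simp add: assms)
  then show ?thesis using assms(1,2) by (simp add: x_of_def prod_eq_iff)
qed

definition space_hat :: "nat \<Rightarrow> nat \<Rightarrow> 'k::field pt set" where
  "space_hat N n = {P. fst P \<in> proj N \<and> length (snd (snd P)) = n}"

lemma amb_eq: "amb N n = zariski (space_hat N n) (coords N n)"
  unfolding amb_def space_hat_def by (rule arg_cong[where f = "\<lambda>S. zariski S (coords N n)"]) auto

lemma topspace_amb [simp]: "topspace (amb N n) = space_hat N n"
  by (simp add: amb_eq)

lemma mem_diamond_iff:
  "P \<in> diamond Y n \<longleftrightarrow> fst P \<in> Y \<and> length (snd (snd P)) = n \<and> (\<forall>i\<in>{1..n}. t_of i P \<noteq> Some 1)"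
proof -
  obtain y x t where P: "P = (y, x, t)" by (metis prod.collapse)
  have "(\<forall>i\<in>{1..n}. t ! (i - 1) \<noteq> Some 1) \<longleftrightarrow> (\<forall>i<n. t ! i \<noteq> Some 1)"
  proof (intro iffI allI impI ballI)
    fix i assume "\<forall>i\<in>{1..n}. t ! (i - 1) \<noteq> Some 1" "i < n"
    then show "t ! i \<noteq> Some 1" by (auto dest!: bspec[of _ _ "Suc i"])
  qed auto
  then show ?thesis by (auto simp: P diamond_def t_of_def in_set_conv_nth)
qed

lemma diamond_subset: "Y \<subseteq> proj N \<Longrightarrow> diamond Y n \<subseteq> space_hat N n"
  by (auto simp: mem_diamond_iff space_hat_def)

text \<open>Homogeneous coordinates as functions of a point of the projective line alone, so that
  they apply to \<tau>(x) as well as to a stored coordinate.\<close>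

definition hnum :: "'k::field alg_closure option \<Rightarrow> 'k alg_closure" where
  "hnum v = (case v of Some a \<Rightarrow> a | None \<Rightarrow> 1)"

definition hden :: "'k::field alg_closure option \<Rightarrow> 'k alg_closure" where
  "hden v = (case v of Some a \<Rightarrow> 1 | None \<Rightarrow> 0)"

lemma t_num_eq: "t_num i P = hnum (t_of i P)" and t_den_eq: "t_den i P = hden (t_of i P)"
  by (simp_all add: t_num_def t_den_def hnum_def hden_def)

lemma hnum_hden_cross: "hnum a * hden b = hnum b * hden a \<longleftrightarrow> a = b"
  by (auto simp: hnum_def hden_def split: option.splits)

lemma hnum_hden_simps [simp]: "hnum (Some a) = a" "hden (Some a) = 1" "hnum None = 1" "hden None = 0"
  by (simp_all add: hnum_def hden_def)

lemma finite_coords: "finite (coords N n :: (_ \<times> ('k::field pt \<Rightarrow> _)) set)"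
proof -
  have "(coords N n :: (_ \<times> ('k pt \<Rightarrow> _)) set) = (\<lambda>i. (unit_deg 0, \<lambda>P. fst P i)) ` {..N} \<union> {(\<lambda>_. 0, x_of)} \<union>
      (\<lambda>i. (unit_deg i, t_num i)) ` {1..n} \<union> (\<lambda>i. (unit_deg i, t_den i)) ` {1..n}"
    unfolding coords_def by blast
  then show ?thesis by simp
qed

lemma finite_irr_components_amb: "S \<subseteq> space_hat N n \<Longrightarrow> finite (irr_components (amb N n) S)"
  unfolding amb_eq by (rule finite_irr_components[OF zariski_noetherian[OF finite_coords]]) simp

lemma mform_coords:
  "mform (coords N n) (\<lambda>_. 0) x_of"
  "i \<le> N \<Longrightarrow> mform (coords N n) (unit_deg 0) (\<lambda>P. fst P i)"
  "i \<in> {1..n} \<Longrightarrow> mform (coords N n) (unit_deg i) (t_num i)"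
  "i \<in> {1..n} \<Longrightarrow> mform (coords N n) (unit_deg i) (t_den i)"
  by (rule mform.coord; force simp: coords_def)+

text \<open>On points with the right number of coordinates \<open>drop_coord n l\<close> is \<open>forget_t l\<close>; unlike the latter
  it pulls the coordinate functions back to coordinate functions on the whole type.\<close>

definition drop_coord :: "nat \<Rightarrow> nat \<Rightarrow> 'k::field pt \<Rightarrow> 'k pt" where
  "drop_coord n l P = mk_pt n (fst P) (x_of P) (\<lambda>i. t_of (if i < l then i else Suc i) P)"

text \<open>The new coordinate is a general function \<tau> of x because two cases occur: 1/x for
  the Connes operator, and the constant 0 for the embedding as a face.\<close>

definition put_coord :: "nat \<Rightarrow> nat \<Rightarrow> ('k alg_closure \<Rightarrow> 'k alg_closure option) \<Rightarrow> 'k::field pt \<Rightarrow> 'k pt" where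
  "put_coord n l \<tau> P = mk_pt (Suc n) (fst P) (x_of P)
     (\<lambda>i. if i < l then t_of i P else if i = l then \<tau> (x_of P) else t_of (i - 1) P)"

text \<open>The degree of a pullback along the deletion of t_l: slots from l on move up by one and
  slot l becomes empty. Slot 0 stays with projective space as long as l \<ge> 1.\<close>

definition drop_deg :: "nat \<Rightarrow> (nat \<Rightarrow> nat) \<Rightarrow> nat \<Rightarrow> nat" where
  "drop_deg l d = (\<lambda>i. if i < l then d i else if i = l then 0 else d (i - 1))"

text \<open>Slot l is lost because the inserted pair becomes polynomial in x, and x has degree
  0.\<close>

definition put_deg :: "nat \<Rightarrow> (nat \<Rightarrow> nat) \<Rightarrow> nat \<Rightarrow> nat" where
  "put_deg l d = (\<lambda>i. if i < l then d i else d (Suc i))"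

lemma drop_deg_unit: "drop_deg l (unit_deg i) = unit_deg (if i < l then i else Suc i)" if "1 \<le> l"
  using that by (auto simp: drop_deg_def unit_deg_def fun_eq_iff)

lemma put_deg_unit: "put_deg l (unit_deg i) = (if i = l then (\<lambda>_. 0) else unit_deg (if i < l then i else i - 1))"
  by (auto simp: put_deg_def unit_deg_def fun_eq_iff)

lemma mform_drop_coord:
  assumes l: "1 \<le> l" "l \<le> Suc n" and F: "mform (coords N n) d F"
  shows "mform (coords N (Suc n)) (drop_deg l d) (\<lambda>P. F (drop_coord n l P))"
proof -
  have "mform (coords N (Suc n)) (drop_deg l d) (\<lambda>P. 1 * F (drop_coord n l P))"
  proof (rule mform_subst[where \<mu> = "\<lambda>_ _. 1", OF F])
    fix e f assume "(e, f) \<in> coords N n"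
    then consider i where "i \<le> N" "e = unit_deg 0" "f = (\<lambda>P. fst P i)" | "e = (\<lambda>_. 0)" "f = x_of"
      | i where "i \<in> {1..n}" "e = unit_deg i" "f = t_num i"
      | i where "i \<in> {1..n}" "e = unit_deg i" "f = t_den i"
      by (auto simp: coords_def)
    then show "mform (coords N (Suc n)) (drop_deg l e) (\<lambda>P. 1 * f (drop_coord n l P))"
    proof cases
      case 1
      with l show ?thesis by (simp add: drop_deg_unit drop_coord_def mform_coords)
    next
      case 2
      moreover have "drop_deg l (\<lambda>_. 0) = (\<lambda>_. 0)" by (auto simp: drop_deg_def)
      ultimately show ?thesis by (simp add: drop_coord_def mform_coords)
    next
      case (3 i)
      then have "(\<lambda>P. 1 * f (drop_coord n l P)) = t_num (if i < l then i else Suc i)"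
        by (intro ext) (simp add: t_num_eq drop_coord_def)
      with 3 l show ?thesis by (simp add: drop_deg_unit mform_coords)
    next
      case (4 i)
      then have "(\<lambda>P. 1 * f (drop_coord n l P)) = t_den (if i < l then i else Suc i)"
        by (intro ext) (simp add: t_den_eq drop_coord_def)
      with 4 l show ?thesis by (simp add: drop_deg_unit mform_coords)
    qed
  qed (auto simp: drop_deg_def fun_eq_iff)
  then show ?thesis by simp
qed

text \<open>The factor \<open>c\<close> passes from the chosen representative of \<open>\<tau>(x) \<in> \<P>\<^sup>1\<close> to one that is polynomial in \<open>x\<close>;
  for \<open>\<tau>(x) = 1/x\<close> it turns \<open>(1/x, 1)\<close> into \<open>(1, x)\<close>.\<close>

locale coord_insertion =
  fixes N n l :: nat and \<tau> :: "'k::field alg_closure \<Rightarrow> 'k alg_closure option" and c :: "'k alg_closure \<Rightarrow> 'k alg_closure"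
  assumes l: "1 \<le> l" "l \<le> Suc n" and c: "c x \<noteq> 0"
    and num: "mform (coords N n) (\<lambda>_. 0) (\<lambda>P. c (x_of P) * hnum (\<tau> (x_of P)))"
    and den: "mform (coords N n) (\<lambda>_. 0) (\<lambda>P. c (x_of P) * hden (\<tau> (x_of P)))"
begin

abbreviation "put \<equiv> put_coord n l \<tau>"
abbreviation dropc :: "'k pt \<Rightarrow> 'k pt" where "dropc \<equiv> drop_coord n l"

text \<open>\<open>F\<close> has degree \<open>d l\<close> in the homogeneous coordinates of t_l, so
  rescaling the representative of \<tau>(x) by c(x) multiplies \<open>F\<close> by that power of
  c(x); the rescaled pair consists of forms by \<open>num\<close> and \<open>den\<close>.\<close>

lemma mform_put:
  assumes F: "mform (coords N (Suc n)) d (F :: 'k pt \<Rightarrow> _)"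
  shows "mform (coords N n) (put_deg l d) (\<lambda>P. c (x_of P) ^ d l * F (put P))"
proof (rule mform_subst[where \<mu> = "\<lambda>d P. c (x_of P) ^ d l", OF F])
  fix e and f :: "'k pt \<Rightarrow> _" assume "(e, f) \<in> coords N (Suc n)"
  then consider i where "i \<le> N" "e = unit_deg 0" "f = (\<lambda>P. fst P i)" | "e = (\<lambda>_. 0)" "f = x_of"
    | i where "i \<in> {1..Suc n}" "e = unit_deg i" "f = t_num i"
    | i where "i \<in> {1..Suc n}" "e = unit_deg i" "f = t_den i"
    by (auto simp: coords_def)
  then show "mform (coords N n) (put_deg l e) (\<lambda>P. c (x_of P) ^ e l * f (put P))"
  proof cases
    case 1
    moreover have "unit_deg 0 l = 0" using l by (simp add: unit_deg_def)
    ultimately show ?thesis using l by (simp add: put_deg_unit put_coord_def mform_coords)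
  next
    case 2
    moreover have "put_deg l (\<lambda>_. 0) = (\<lambda>_. 0)" by (auto simp: put_deg_def)
    ultimately show ?thesis by (simp add: put_coord_def mform_coords)
  next
    case (3 i)
    show ?thesis
    proof (cases "i = l")
      case True
      with 3 have "(\<lambda>P. c (x_of P) ^ e l * f (put P)) = (\<lambda>P. c (x_of P) * hnum (\<tau> (x_of P)))"
        by (intro ext) (simp add: t_num_eq put_coord_def unit_deg_def)
      moreover have "put_deg l e = (\<lambda>_. 0)" using 3 True by (simp add: put_deg_unit)
      ultimately show ?thesis using num by simp
    next
      case False
      then have eq: "(\<lambda>P. c (x_of P) ^ e l * f (put P)) = t_num (if i < l then i else i - 1)"
        using 3 by (intro ext) (simp add: t_num_eq put_coord_def unit_deg_def)
      have deg: "put_deg l e = unit_deg (if i < l then i else i - 1)"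
        using 3 False by (simp add: put_deg_unit)
      have "(if i < l then i else i - 1) \<in> {1..n}" using 3 l False by auto
      then show ?thesis unfolding eq deg by (rule mform_coords(3))
    qed
  next
    case (4 i)
    show ?thesis
    proof (cases "i = l")
      case True
      with 4 have "(\<lambda>P. c (x_of P) ^ e l * f (put P)) = (\<lambda>P. c (x_of P) * hden (\<tau> (x_of P)))"
        by (intro ext) (simp add: t_den_eq put_coord_def unit_deg_def)
      moreover have "put_deg l e = (\<lambda>_. 0)" using 4 True by (simp add: put_deg_unit)
      ultimately show ?thesis using den by simp
    next
      case False
      then have eq: "(\<lambda>P. c (x_of P) ^ e l * f (put P)) = t_den (if i < l then i else i - 1)"
        using 4 by (intro ext) (simp add: t_den_eq put_coord_def unit_deg_def)
      have deg: "put_deg l e = unit_deg (if i < l then i else i - 1)"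
        using 4 False by (simp add: put_deg_unit)
      have "(if i < l then i else i - 1) \<in> {1..n}" using 4 l False by auto
      then show ?thesis unfolding eq deg by (rule mform_coords(4))
    qed
  qed
qed (auto simp: put_deg_def fun_eq_iff power_add)

lemma put_simps [simp]: "x_of (put P) = x_of P" "fst (put P) = fst P" "length (snd (snd (put P))) = Suc n"
  "x_of (dropc P) = x_of P" "fst (dropc P) = fst P" "length (snd (snd (dropc P))) = n"
  by (simp_all add: put_coord_def drop_coord_def)

lemma t_of_put: "i \<in> {1..Suc n} \<Longrightarrow>
    t_of i (put P) = (if i < l then t_of i P else if i = l then \<tau> (x_of P) else t_of (i - 1) P)"
  by (simp add: put_coord_def)

lemma t_of_drop: "i \<in> {1..n} \<Longrightarrow> t_of i (dropc P) = t_of (if i < l then i else Suc i) P"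
  by (simp add: drop_coord_def)

lemma put_in_space: "P \<in> space_hat N n \<Longrightarrow> put P \<in> space_hat N (Suc n)"
  and drop_in_space: "Q \<in> space_hat N (Suc n) \<Longrightarrow> dropc Q \<in> space_hat N n"
  by (simp_all add: space_hat_def)

lemma drop_put: "P \<in> space_hat N n \<Longrightarrow> dropc (put P) = P"
  using l by (intro pt_eqI[of _ _ n]) (auto simp: space_hat_def t_of_drop t_of_put)

lemma put_drop: "P \<in> space_hat N (Suc n) \<Longrightarrow> t_of l P = \<tau> (x_of P) \<Longrightarrow> put (dropc P) = P"
proof (rule pt_eqI[of _ _ "Suc n"])
  fix i assume "t_of l P = \<tau> (x_of P)" "i \<in> {1..Suc n}"
  moreover from this l have "i - 1 \<in> {1..n}" if "l < i" using that by auto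
  ultimately show "t_of i (put (dropc P)) = t_of i P"
    using l by (cases i l rule: linorder_cases) (auto simp: t_of_put t_of_drop)
qed (auto simp: space_hat_def)

lemma continuous_put: "continuous_map (amb N n) (amb N (Suc n)) put"
  unfolding amb_eq
proof (rule continuous_map_zariski)
  fix d and F :: "'k pt \<Rightarrow> _" assume F: "mform (coords N (Suc n)) d F"
  have "c (x_of P) ^ d l \<noteq> 0" for P :: "'k pt" using c by simp
  then show "\<exists>e H. mform (coords N n) e H \<and> (\<forall>P\<in>space_hat N n. H P \<noteq> 0 \<longleftrightarrow> F (put P) \<noteq> 0)"
    using mform_put[OF F] by (intro exI[of _ "put_deg l d"] exI[of _ "\<lambda>P. c (x_of P) ^ d l * F (put P)"]) simp
qed (rule put_in_space)

lemma continuous_drop: "continuous_map (amb N (Suc n)) (amb N n) dropc"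
  unfolding amb_eq
proof (rule continuous_map_zariski)
  fix d and F :: "'k pt \<Rightarrow> _" assume F: "mform (coords N n) d F"
  show "\<exists>e H. mform (coords N (Suc n)) e H \<and> (\<forall>P\<in>space_hat N (Suc n). H P \<noteq> 0 \<longleftrightarrow> F (dropc P) \<noteq> 0)"
    using mform_drop_coord[OF l F]
    by (intro exI[of _ "drop_deg l d"] exI[of _ "\<lambda>P. F (dropc P)"]) simp
qed (rule drop_in_space)

text \<open>The graph of \<tau> is the zero set of the determinant of two representatives of points
  of the projective line. The factor c has no zeros and turns this determinant into a form.\<close>

lemma closedin_range_put: "closedin (amb N (Suc n)) {P \<in> space_hat N (Suc n). t_of l P = \<tau> (x_of P)}"
proof -
  have zero: "drop_deg l (\<lambda>_. 0) = (\<lambda>_. 0)" by (auto simp: drop_deg_def)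
  have forms: "mform (coords N (Suc n)) (\<lambda>_. 0) (\<lambda>P. c (x_of P) * hnum (\<tau> (x_of P)))"
    "mform (coords N (Suc n)) (\<lambda>_. 0) (\<lambda>P. c (x_of P) * hden (\<tau> (x_of P)))"
    using mform_drop_coord[OF l num] mform_drop_coord[OF l den] by (simp_all add: zero)
  have li: "l \<in> {1..Suc n}" using l by simp
  have "closedin (amb N (Suc n)) {P \<in> space_hat N (Suc n).
      t_num l P * (c (x_of P) * hden (\<tau> (x_of P))) - c (x_of P) * hnum (\<tau> (x_of P)) * t_den l P = 0}"
    unfolding amb_eq
    by (rule closedin_zariski_mform[OF mform_cross_diff[OF mform_coords(3,4)[OF li] forms]])
  moreover have "t_num l P * (c (x_of P) * hden (\<tau> (x_of P))) - c (x_of P) * hnum (\<tau> (x_of P)) * t_den l P = 0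
      \<longleftrightarrow> t_of l P = \<tau> (x_of P)" for P :: "'k pt"
  proof -
    have "t_num l P * (c (x_of P) * hden (\<tau> (x_of P))) - c (x_of P) * hnum (\<tau> (x_of P)) * t_den l P =
      c (x_of P) * (hnum (t_of l P) * hden (\<tau> (x_of P)) - hnum (\<tau> (x_of P)) * hden (t_of l P))"
      by (simp add: t_num_eq t_den_eq algebra_simps)
    then show ?thesis using c hnum_hden_cross by (metis mult_eq_0_iff right_minus_eq)
  qed
  ultimately show ?thesis by simp
qed

lemma put_in_diamond: "P \<in> diamond Y n \<Longrightarrow> \<tau> (x_of P) \<noteq> Some 1 \<Longrightarrow> put P \<in> diamond Y (Suc n)"
proof -
  assume P: "P \<in> diamond Y n" and \<tau>: "\<tau> (x_of P) \<noteq> Some 1"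
  have "t_of i (put P) \<noteq> Some 1" if i: "i \<in> {1..Suc n}" for i
  proof -
    have "i - 1 \<in> {1..n}" if "l < i" using that i l by auto
    then show ?thesis using P \<tau> i l
      by (cases i l rule: linorder_cases) (auto simp: mem_diamond_iff t_of_put)
  qed
  then show ?thesis using P by (simp add: mem_diamond_iff)
qed

lemma drop_in_diamond: "P \<in> diamond Y (Suc n) \<Longrightarrow> dropc P \<in> diamond Y n"
  using l by (auto simp: mem_diamond_iff t_of_drop)

end

section \<open>List operations on points in terms of coordinates\<close>

lemma forget_t_simps:
  assumes "1 \<le> l" "l \<le> Suc n" "length (snd (snd P)) = Suc n"
  shows "fst (forget_t l P) = fst P" "x_of (forget_t l P) = x_of P" "length (snd (snd (forget_t l P))) = n"
    and "i \<in> {1..n} \<Longrightarrow> t_of i (forget_t l P) = t_of (if i < l then i else Suc i) P"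
proof -
  obtain y x t where P: "P = (y, x, t)" by (metis prod.collapse)
  show "fst (forget_t l P) = fst P" "x_of (forget_t l P) = x_of P" "length (snd (snd (forget_t l P))) = n"
    "i \<in> {1..n} \<Longrightarrow> t_of i (forget_t l P) = t_of (if i < l then i else Suc i) P"
    using assms by (auto simp: P forget_t_def x_of_def t_of_def nth_append)
qed

lemma insert_inv_x_simps:
  assumes "1 \<le> l" "l \<le> Suc n" "length (snd (snd P)) = n"
  shows "fst (insert_inv_x l P) = fst P" "x_of (insert_inv_x l P) = x_of P"
    and "length (snd (snd (insert_inv_x l P))) = Suc n"
    and "i \<in> {1..Suc n} \<Longrightarrow> t_of i (insert_inv_x l P) =
      (if i < l then t_of i P else if i = l then Some (1 / x_of P) else t_of (i - 1) P)"
proof -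
  obtain y x t where P: "P = (y, x, t)" by (metis prod.collapse)
  show "fst (insert_inv_x l P) = fst P" "x_of (insert_inv_x l P) = x_of P"
    "length (snd (snd (insert_inv_x l P))) = Suc n"
    using assms by (auto simp: P insert_inv_x_def x_of_def)
  show "t_of i (insert_inv_x l P) =
      (if i < l then t_of i P else if i = l then Some (1 / x_of P) else t_of (i - 1) P)"
    if i: "i \<in> {1..Suc n}"
  proof (cases i l rule: linorder_cases)
    case greater
    then have "i - 1 - (l - 1) = Suc (i - 1 - l)" "l - 1 + (i - 1 - l) = i - 1 - 1" using assms(1) by auto
    with greater show ?thesis using assms i by (auto simp: P insert_inv_x_def t_of_def nth_append)
  qed (use assms i in \<open>auto simp: P insert_inv_x_def t_of_def x_of_def nth_append\<close>)
qed

lemma forget_t_eq: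
  assumes "1 \<le> l" "l \<le> Suc n" "length (snd (snd P)) = Suc n"
  shows "forget_t l P = drop_coord n l P"
  using assms by (intro pt_eqI[of _ _ n]) (auto simp: forget_t_simps[OF assms] drop_coord_def)

definition inv_x :: "'k::field alg_closure \<Rightarrow> 'k alg_closure option" where
  "inv_x x = (if x = 0 then None else Some (1 / x))"

lemma insert_inv_x_eq:
  assumes "1 \<le> l" "l \<le> Suc n" "length (snd (snd P)) = n" "x_of P \<noteq> 0"
  shows "insert_inv_x l P = put_coord n l inv_x P"
  using assms by (intro pt_eqI[of _ _ "Suc n"]) (auto simp: insert_inv_x_simps[OF assms(1-3)] put_coord_def inv_x_def)

text \<open>At x = 0 the stored representative of \<infinity> is already (1, 0), so the factor there
  is 1; with the factor x elsewhere, the rescaled pair is (1, x) throughout.\<close>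

lemma coord_insertion_inv_x:
  assumes "1 \<le> l" "l \<le> Suc n"
  shows "coord_insertion N n l (inv_x :: 'k::field alg_closure \<Rightarrow> _) (\<lambda>x. if x = 0 then 1 else x)"
proof
  have "(\<lambda>P. (if x_of P = 0 then 1 else x_of P) * hnum (inv_x (x_of P))) = (\<lambda>P :: 'k pt. to_ac 1)"
    by (auto simp: inv_x_def)
  then show "mform (coords N n) (\<lambda>_. 0)
      (\<lambda>P :: 'k pt. (if x_of P = 0 then 1 else x_of P) * hnum (inv_x (x_of P)))"
    by (simp only: mform.const)
  have "(\<lambda>P. (if x_of P = 0 then 1 else x_of P) * hden (inv_x (x_of P))) = (x_of :: 'k pt \<Rightarrow> _)"
    by (auto simp: inv_x_def)
  then show "mform (coords N n) (\<lambda>_. 0)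
      (\<lambda>P :: 'k pt. (if x_of P = 0 then 1 else x_of P) * hden (inv_x (x_of P)))"
    by (simp only: mform_coords)
qed (use assms in auto)

lemma coord_insertion_zero:
  assumes "1 \<le> l" "l \<le> Suc n"
  shows "coord_insertion N n l (\<lambda>_. Some 0) (\<lambda>_. 1)"
  using assms mform.const[of "coords N n" 0] mform.const[of "coords N n" 1]
  by unfold_locales auto


section \<open>The Connes operator on integral cycles\<close>

declare split_paired_All [simp del] split_paired_Ex [simp del]

text \<open>Points with x = 0 are kept, with t_l = \<infinity>, since the closure in
  \<open>connes_part\<close> restores them.\<close>

definition connes_image :: "nat \<Rightarrow> nat \<Rightarrow> 'k::field pt set \<Rightarrow> 'k pt set" where
  "connes_image n l Z = put_coord n l inv_x ` {P \<in> Z. x_of P \<noteq> 1}"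

lemma openin_x_neq: "openin (amb N n) {P \<in> space_hat N n. x_of P \<noteq> to_ac a}"
  using openin_zariski_mform[OF mform_diff[OF mform_coords(1) mform.const], of "space_hat N n" N n a]
  by (simp add: amb_eq)

definition x_not_1 :: "nat \<Rightarrow> nat \<Rightarrow> 'k::field pt set" where
  "x_not_1 N n = {P \<in> space_hat N n. x_of P \<noteq> 1}"

lemma open_x_not_1: "openin (amb N n) (x_not_1 N n)"
  using openin_x_neq[of N n 1] by (simp add: x_not_1_def)

lemma inv_x_neq_1: "inv_x x \<noteq> Some 1 \<longleftrightarrow> x \<noteq> 1"
  by (auto simp: inv_x_def)

text \<open>For one inclusion, the graph of 1/x over a closed set cutting out \<open>Z\<close> is
  closed and contains the image. For the other, the points with x neither 0 nor 1 are dense in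
  \<open>Z\<close>, and a continuous map respects closures. Here \<open>ne\<close> matters: for
  \<open>Z\<close> inside x = 0 the closure is empty, while \<open>connes_image\<close> is
  not.\<close>

lemma connes_closure_eq:
  assumes Y: "Y \<subseteq> proj N" and l: "1 \<le> l" "l \<le> Suc n"
    and closed: "closedin (subtopology (amb N n) (diamond Y n)) Z" and irr: "irreducible_in (amb N n) Z"
    and ne: "{P \<in> Z. x_of P \<noteq> 0 \<and> x_of P \<noteq> 1} \<noteq> {}"
  shows "diamond Y (Suc n) \<inter> (amb N (Suc n) closure_of (insert_inv_x l ` {P \<in> Z. x_of P \<noteq> 0 \<and> x_of P \<noteq> 1})) =
         connes_image n l Z"
proof -
  interpret coord_insertion N n l inv_x "\<lambda>x. if x = 0 then 1 else x" using l by (rule coord_insertion_inv_x)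
  define U where "U = {P \<in> Z. x_of P \<noteq> 0 \<and> x_of P \<noteq> 1}"
  have Z: "Z \<subseteq> diamond Y n" using closedin_subset[OF closed] by simp
  then have Zs: "Z \<subseteq> space_hat N n" using diamond_subset[OF Y] by blast
  have img: "insert_inv_x l ` U = put ` U"
    using Zs by (intro image_cong refl insert_inv_x_eq l) (auto simp: U_def space_hat_def)
  obtain C where C: "closedin (amb N n) C" "Z = C \<inter> diamond Y n"
    using closed by (auto simp: closedin_subtopology)
  have closed': "closedin (amb N (Suc n)) ({P \<in> space_hat N (Suc n). t_of l P = inv_x (x_of P)} \<inter>
      {P \<in> topspace (amb N (Suc n)). dropc P \<in> C})"
    by (intro closedin_Int closedin_range_put closedin_continuous_map_preimage[OF continuous_drop] C(1))
  have "put ` U \<subseteq> {P \<in> space_hat N (Suc n). t_of l P = inv_x (x_of P)} \<inter>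
      {P \<in> topspace (amb N (Suc n)). dropc P \<in> C}"
    using Zs C(2) l by (auto simp: U_def put_in_space drop_put t_of_put)
  then have "amb N (Suc n) closure_of (put ` U) \<subseteq> {P \<in> space_hat N (Suc n). t_of l P = inv_x (x_of P)} \<inter>
      {P \<in> topspace (amb N (Suc n)). dropc P \<in> C}"
    using closed' by (rule closure_of_minimal)
  then have "diamond Y (Suc n) \<inter> amb N (Suc n) closure_of (put ` U) \<subseteq> connes_image n l Z"
  proof (intro subsetI)
    fix P assume sub: "amb N (Suc n) closure_of (put ` U) \<subseteq> {P \<in> space_hat N (Suc n). t_of l P = inv_x (x_of P)} \<inter>
      {P \<in> topspace (amb N (Suc n)). dropc P \<in> C}" and P: "P \<in> diamond Y (Suc n) \<inter> amb N (Suc n) closure_of (put ` U)"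
    then have P': "P \<in> space_hat N (Suc n)" "t_of l P = inv_x (x_of P)" "dropc P \<in> C" by auto
    then have "dropc P \<in> Z" using drop_in_diamond P C(2) by blast
    moreover have "t_of l P \<noteq> Some 1" using P l by (simp add: mem_diamond_iff)
    then have "x_of (dropc P) \<noteq> 1" using P'(2) by (simp add: inv_x_neq_1)
    ultimately show "P \<in> connes_image n l Z"
      using put_drop[OF P'(1,2)] unfolding connes_image_def by (metis (mono_tags, lifting) imageI mem_Collect_eq)
  qed
  moreover have "connes_image n l Z \<subseteq> diamond Y (Suc n)"
  proof
    fix P assume "P \<in> connes_image n l Z"
    then obtain Q where Q: "Q \<in> Z" "x_of Q \<noteq> 1" "P = put Q" unfolding connes_image_def by blast
    then have "Q \<in> diamond Y n" "inv_x (x_of Q) \<noteq> Some 1" using Z by (auto simp: inv_x_neq_1)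
    then show "P \<in> diamond Y (Suc n)" unfolding Q(3) by (rule put_in_diamond)
  qed
  moreover have "connes_image n l Z \<subseteq> amb N (Suc n) closure_of (put ` U)"
  proof -
    let ?O = "{P \<in> space_hat N n. x_of P \<noteq> to_ac 0} \<inter> {P \<in> space_hat N n. x_of P \<noteq> to_ac 1}"
    have "U = Z \<inter> ?O" using Zs by (auto simp: U_def)
    moreover have "openin (amb N n) ?O" by (intro openin_Int openin_x_neq)
    ultimately have "Z \<subseteq> amb N n closure_of U"
      using irreducible_in_Int_open_dense[OF irr] ne by (simp add: U_def)
    then have "put ` Z \<subseteq> put ` (amb N n closure_of U)" by blast
    also have "\<dots> \<subseteq> amb N (Suc n) closure_of (put ` U)"
      by (rule continuous_map_image_closure_subset[OF continuous_put])
    finally show ?thesis by (auto simp: connes_image_def)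
  qed
  ultimately show ?thesis unfolding img[unfolded U_def] U_def[symmetric] img by blast
qed

lemma connes_part_frag_of:
  assumes "Y \<subseteq> proj N" "1 \<le> l" "l \<le> Suc n"
    and "closedin (subtopology (amb N n) (diamond Y n)) Z" "irreducible_in (amb N n) Z"
  shows "connes_part Y N n l (frag_of Z) =
    (if {P \<in> Z. x_of P \<noteq> 0 \<and> x_of P \<noteq> 1} = {} then 0 else frag_of (connes_image n l Z))"
  using connes_closure_eq[OF assms] by (simp add: connes_part_def Let_def)

section \<open>The face t_n = 0 before and after inserting 1/x at a position l \<le> n\<close>

context
  fixes N n l :: nat and Y :: "(nat \<Rightarrow> 'k::field alg_closure) set" and Z :: "'k pt set"
  assumes Y: "Y \<subseteq> proj N" and l_range: "1 \<le> l" "l \<le> n"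
    and closed: "closedin (subtopology (amb N n) (diamond Y n)) Z" and irr: "irreducible_in (amb N n) Z"
begin

interpretation coord_insertion N n l inv_x "\<lambda>x. if x = 0 then 1 else x"
  using l_range by (intro coord_insertion_inv_x) auto

lemma Z_subset: "Z \<subseteq> diamond Y n" "Z \<subseteq> space_hat N n"
  using closedin_subset[OF closed] diamond_subset[OF Y, of n] by auto

lemma connes_image_eq: "W \<subseteq> Z \<Longrightarrow> connes_image n l W = put ` (W \<inter> x_not_1 N n)"
  using Z_subset(2) unfolding connes_image_def x_not_1_def by (intro image_cong) auto

lemma inj_put: "inj_on put (space_hat N n)"
  by (rule inj_on_inverseI) (rule drop_put)

text \<open>As l \<le> n, the last coordinate survives the insertion with number n + 1. The
  insertion is a homeomorphism onto its image, so what remains is restriction to the open set where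
  x is not 1, which loses exactly the components inside x = 1.\<close>

lemma components_connes_image:
  "irr_components (amb N (Suc n)) (connes_image n l Z \<inter> face Y (Suc n) (Suc n) (Some 0)) =
   connes_image n l ` {W \<in> irr_components (amb N n) (Z \<inter> face Y n n (Some 0)). W \<inter> x_not_1 N n \<noteq> {}}"
proof -
  have eq: "connes_image n l Z \<inter> face Y (Suc n) (Suc n) (Some 0) = put ` (Z \<inter> face Y n n (Some 0) \<inter> x_not_1 N n)"
  proof -
    have "put P \<in> face Y (Suc n) (Suc n) (Some 0) \<longleftrightarrow> P \<in> face Y n n (Some 0)" if "P \<in> Z \<inter> x_not_1 N n" for P
    proof -
      have P: "P \<in> diamond Y n" "x_of P \<noteq> 1" using that Z_subset by (auto simp: x_not_1_def)
      then have "put P \<in> diamond Y (Suc n)" by (intro put_in_diamond) (simp_all add: inv_x_neq_1)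
      with P(1) show ?thesis using l_range by (simp add: face_def t_of_put)
    qed
    then show ?thesis unfolding connes_image_eq[OF order.refl] by blast
  qed
  have sub: "Z \<inter> face Y n n (Some 0) \<inter> x_not_1 N n \<subseteq> topspace (amb N n)" using Z_subset by auto
  have "irr_components (amb N (Suc n)) (connes_image n l Z \<inter> face Y (Suc n) (Suc n) (Some 0)) =
      (`) put ` irr_components (amb N n) (Z \<inter> face Y n n (Some 0) \<inter> x_not_1 N n)"
    unfolding eq by (rule irr_components_image[OF continuous_put continuous_drop _ sub]) (simp add: drop_put)
  also have "\<dots> = (\<lambda>W. put ` (W \<inter> x_not_1 N n)) ` {W \<in> irr_components (amb N n) (Z \<inter> face Y n n (Some 0)). W \<inter> x_not_1 N n \<noteq> {}}"
    unfolding irr_components_Int_open[OF open_x_not_1] image_image ..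
  also have "\<dots> = connes_image n l ` {W \<in> irr_components (amb N n) (Z \<inter> face Y n n (Some 0)). W \<inter> x_not_1 N n \<noteq> {}}"
    by (rule image_cong[OF refl]) (auto dest!: irr_componentsD(2) simp: connes_image_eq)
  finally show ?thesis .
qed

text \<open>A component is recovered from its part with x not 1 as the closure of that part in the
  face.\<close>

lemma inj_on_connes_image:
  "inj_on (connes_image n l) {W \<in> irr_components (amb N n) (Z \<inter> face Y n n (Some 0)). W \<inter> x_not_1 N n \<noteq> {}}"
proof (rule inj_onI)
  fix W V assume "W \<in> {W \<in> irr_components (amb N n) (Z \<inter> face Y n n (Some 0)). W \<inter> x_not_1 N n \<noteq> {}}"
    "V \<in> {W \<in> irr_components (amb N n) (Z \<inter> face Y n n (Some 0)). W \<inter> x_not_1 N n \<noteq> {}}"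
    and eq: "connes_image n l W = connes_image n l V"
  then have W: "W \<in> irr_components (amb N n) (Z \<inter> face Y n n (Some 0))" "W \<inter> x_not_1 N n \<noteq> {}"
    and V: "V \<in> irr_components (amb N n) (Z \<inter> face Y n n (Some 0))" "V \<inter> x_not_1 N n \<noteq> {}" by auto
  note W' = irr_componentsD[OF W(1)] and V' = irr_componentsD[OF V(1)]
  have "put ` (W \<inter> x_not_1 N n) = put ` (V \<inter> x_not_1 N n)"
    using eq W'(2) V'(2) by (simp add: connes_image_eq)
  moreover have "W \<inter> x_not_1 N n \<subseteq> space_hat N n" "V \<inter> x_not_1 N n \<subseteq> space_hat N n" by (auto simp: x_not_1_def)
  ultimately have same: "W \<inter> x_not_1 N n = V \<inter> x_not_1 N n" using inj_on_image_eq_iff[OF inj_put] by blast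
  have sub: "W \<subseteq> amb N n closure_of V"
    using irreducible_in_Int_open_dense[OF W'(1) open_x_not_1 W(2)] closure_of_mono[of "W \<inter> x_not_1 N n" V "amb N n"]
    by (auto simp: same)
  then have "W \<subseteq> V" using irr_component_closed[OF V(1)] W'(2) by blast
  then show "W = V" using W'(3)[OF V'(1) _ V'(2)] by simp
qed

text \<open>Deleting t_l identifies the image of \<open>Z\<close> with the dense open part of
  \<open>Z\<close> where x is not 1. This gives isomorphic local rings along \<open>W\<close>, and
  the local equation t_n is pulled back to t_{n+1}.\<close>

lemma face_mult_connes_image:
  assumes W: "W \<in> irr_components (amb N n) (Z \<inter> face Y n n (Some 0))" "W \<inter> x_not_1 N n \<noteq> {}"
  shows "face_mult N (Suc n) (Suc n) (Some 0) (connes_image n l Z) (connes_image n l W) =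
         face_mult N n n (Some 0) Z W"
proof -
  note W' = irr_componentsD[OF W(1)]
  have WZ: "W \<subseteq> Z" using W'(2) by blast
  have ne: "Z \<inter> x_not_1 N n \<noteq> {}" using W(2) WZ by blast
  let ?Z = "connes_image n l Z" and ?W = "connes_image n l W"
  have drop_image: "dropc ` connes_image n l V = V \<inter> x_not_1 N n" if "V \<subseteq> Z" for V
    using that drop_put by (force simp: connes_image_eq image_image x_not_1_def)
  have irr_image: "irreducible_in (amb N (Suc n)) (connes_image n l V)"
    if "irreducible_in (amb N n) V" "V \<subseteq> Z" "V \<inter> x_not_1 N n \<noteq> {}" for V
    unfolding connes_image_eq[OF that(2)]
    by (rule irreducible_in_image[OF irreducible_in_Int_open[OF that(1) open_x_not_1 that(3)] continuous_put])
  interpret local_ring_comparison "space_hat N n" "coords N n" Z W "space_hat N (Suc n)" "coords N (Suc n)" ?Z ?W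
    dropc "drop_deg l" "put_deg l" "\<lambda>d P. (if x_of P = 0 then 1 else x_of P) ^ d l"
  proof unfold_locales
    show "irreducible_in (zariski (space_hat N n) (coords N n)) Z"
      "irreducible_in (zariski (space_hat N n) (coords N n)) W" using irr W'(1) by (simp_all add: amb_eq)
    show "irreducible_in (zariski (space_hat N (Suc n)) (coords N (Suc n))) ?Z"
      "irreducible_in (zariski (space_hat N (Suc n)) (coords N (Suc n))) ?W"
      using irr_image[OF irr order.refl ne] irr_image[OF W'(1) WZ W(2)] by (simp_all add: amb_eq)
    show "mform (coords N (Suc n)) (drop_deg l d) (\<lambda>P. F (dropc P))" if "mform (coords N n) d F" for d F
      using l that by (intro mform_drop_coord) auto
    show "\<exists>F. mform (coords N n) (put_deg l d) F \<and>
        (\<forall>P\<in>?Z. F (dropc P) = (if x_of P = 0 then 1 else x_of P) ^ d l * F' P)"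
      if "mform (coords N (Suc n)) d F'" for d F'
    proof (intro exI conjI ballI)
      show "mform (coords N n) (put_deg l d) (\<lambda>P. (if x_of P = 0 then 1 else x_of P) ^ d l * F' (put P))"
        using that by (rule mform_put)
      fix P assume "P \<in> ?Z"
      then obtain Q where "P = put Q" "Q \<in> space_hat N n" using Z_subset(2) by (auto simp: connes_image_def)
      then show "(if x_of (dropc P) = 0 then 1 else x_of (dropc P)) ^ d l * F' (put (dropc P)) =
          (if x_of P = 0 then 1 else x_of P) ^ d l * F' P" by (simp add: drop_put)
    qed
    show "dropc ` ?Z \<subseteq> Z" "dropc ` ?W \<subseteq> W" "?W \<subseteq> ?Z"
      using drop_image[OF order.refl] drop_image[OF WZ] WZ by (auto simp: connes_image_def)
    show "Z \<subseteq> zariski (space_hat N n) (coords N n) closure_of (dropc ` ?Z)"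
      "W \<subseteq> zariski (space_hat N n) (coords N n) closure_of (dropc ` ?W)"
      using irreducible_in_Int_open_dense[OF irr open_x_not_1 ne]
        irreducible_in_Int_open_dense[OF W'(1) open_x_not_1 W(2)]
      unfolding drop_image[OF order.refl] drop_image[OF WZ] by (simp_all add: amb_eq)
  qed simp
  have n: "n \<in> {1..n}" using l_range by simp
  have "W \<noteq> {}" using W(2) by blast
  then obtain P where P: "P \<in> W" by blast
  then have "t_of n P = Some 0" using W'(2) by (auto simp: face_def)
  \<comment> \<open>On the face t_n is finite, so the fraction representing it is regular along
    \<open>W\<close>.\<close>
  then have nz: "\<exists>P\<in>W. t_den n P \<noteq> 0" by (intro bexI[of _ P]) (simp_all add: t_den_eq P)
  then have fr: "(t_num n, t_den n) \<in> fracs (coords N n) Z"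
    using mform_coords(3,4)[OF n] WZ unfolding fracs_def by blast
  \<comment> \<open>As l \<le> n, deletion of t_l renumbers t_{n+1} as t_n; the equalities hold on
    the whole type.\<close>
  have eq: "(\<lambda>P. t_num n (dropc P)) = t_num (Suc n)" "(\<lambda>P. t_den n (dropc P)) = t_den (Suc n)"
    using l_range by (auto intro!: ext simp: t_num_eq t_den_eq t_of_drop)
  show ?thesis
    using quot_length_pullback[OF fr nz] unfolding eq by (simp add: face_mult_def Let_def)
qed

end

section \<open>Deleting the last coordinate on components of the face\<close>

lemma forget_t_put_coord:
  assumes l: "1 \<le> l" "l \<le> Suc k" and P: "length (snd (snd P)) = Suc k"
  shows "forget_t (Suc (Suc k)) (put_coord (Suc k) l \<tau> P) = put_coord k l \<tau> (forget_t (Suc k) P)"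
proof -
  define Q where "Q = put_coord (Suc k) l \<tau> P"
  have len: "length (snd (snd Q)) = Suc (Suc k)"
    and Q: "fst Q = fst P" "x_of Q = x_of P" "\<And>i. i \<in> {1..Suc (Suc k)} \<Longrightarrow>
      t_of i Q = (if i < l then t_of i P else if i = l then \<tau> (x_of P) else t_of (i - 1) P)"
    by (simp_all add: Q_def put_coord_def)
  note simps = forget_t_simps[OF _ _ P, of "Suc k"] forget_t_simps[OF _ _ len, of "Suc (Suc k)"] Q
  show ?thesis
    unfolding Q_def[symmetric]
  proof (rule pt_eqI[of _ _ "Suc k"])
    fix i assume i: "i \<in> {1..Suc k}"
    have "i - 1 \<in> {1..k}" if "l < i" using that i l by auto
    moreover have "i \<in> {1..k}" if "i < l" using that i l by auto
    ultimately show "t_of i (forget_t (Suc (Suc k)) Q) = t_of i (put_coord k l \<tau> (forget_t (Suc k) P))"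
      using i by (cases i l rule: linorder_cases) (auto simp: simps put_coord_def)
  qed (simp_all add: simps put_coord_def)
qed

lemma forget_connes_image:
  assumes "1 \<le> l" "l \<le> Suc k" "W \<subseteq> space_hat N (Suc k)"
  shows "forget_t (Suc (Suc k)) ` connes_image (Suc k) l W = connes_image k l (forget_t (Suc k) ` W)"
proof -
  have P: "x_of (forget_t (Suc k) P) = x_of P"
    "forget_t (Suc (Suc k)) (put_coord (Suc k) l inv_x P) = put_coord k l inv_x (forget_t (Suc k) P)"
    if "P \<in> W" for P
    using forget_t_put_coord[OF assms(1,2), of P inv_x] forget_t_simps(2)[of "Suc k" k P] that assms(3)
    by (auto simp: space_hat_def)
  have "{Q \<in> forget_t (Suc k) ` W. x_of Q \<noteq> 1} = forget_t (Suc k) ` {P \<in> W. x_of P \<noteq> 1}"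
    using P(1) by (auto)
  then show ?thesis
    unfolding connes_image_def by (simp only: image_image) (rule image_cong, auto simp: P)
qed

text \<open>On the face, deletion of the last coordinate is inverse to insertion of 0, so closedness
  is seen from a preimage under the continuous insertion. Both properties are what
  \<open>connes_part_frag_of\<close> asks for in order to evaluate \<open>connes_part\<close> on the
  components.\<close>

lemma forget_zero_face_component:
  assumes Y: "Y \<subseteq> proj N" and closed: "closedin (subtopology (amb N (Suc k)) (diamond Y (Suc k))) Z"
    and W: "W \<in> irr_components (amb N (Suc k)) (Z \<inter> face Y (Suc k) (Suc k) (Some 0))"
  shows "irreducible_in (amb N k) (forget_t (Suc k) ` W)"
    and "closedin (subtopology (amb N k) (diamond Y k)) (forget_t (Suc k) ` W)"
proof -
  interpret coord_insertion N k "Suc k" "\<lambda>_. Some 0" "\<lambda>_. 1" by (rule coord_insertion_zero) auto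
  note W' = irr_componentsD[OF W]
  have WD: "W \<subseteq> diamond Y (Suc k)" using W'(2) by (auto simp: face_def)
  then have Ws: "W \<subseteq> space_hat N (Suc k)" using diamond_subset[OF Y] by blast
  have img: "forget_t (Suc k) ` W = dropc ` W"
    using Ws by (intro image_cong refl forget_t_eq) (auto simp: space_hat_def)
  show "irreducible_in (amb N k) (forget_t (Suc k) ` W)"
    unfolding img using W'(1) continuous_drop by (rule irreducible_in_image)
  obtain C where C: "closedin (amb N (Suc k)) C" "Z = C \<inter> diamond Y (Suc k)"
    using closed by (auto simp: closedin_subtopology)
  \<comment> \<open>Intersecting with the closure of \<open>W\<close> separates this component from
    the others of the face.\<close>
  define C' where "C' = C \<inter> amb N (Suc k) closure_of W"
  have "closedin (amb N (Suc k)) C'" unfolding C'_def using C(1) by (intro closedin_Int) auto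
  then have "closedin (amb N k) {Q \<in> topspace (amb N k). put Q \<in> C'}"
    by (rule closedin_continuous_map_preimage[OF continuous_put])
  moreover have "dropc ` W = {Q \<in> topspace (amb N k). put Q \<in> C'} \<inter> diamond Y k"
  proof (intro equalityI subsetI)
    fix Q assume "Q \<in> dropc ` W"
    then obtain P where P: "P \<in> W" "Q = dropc P" by blast
    then have "P \<in> space_hat N (Suc k)" "t_of (Suc k) P = Some 0" using Ws W'(2) by (auto simp: face_def)
    then have "put Q = P" unfolding P(2) by (rule put_drop)
    moreover have "P \<in> C'"
      using P(1) W'(2) C(2) irr_component_closed[OF W] unfolding C'_def by blast
    ultimately show "Q \<in> {Q \<in> topspace (amb N k). put Q \<in> C'} \<inter> diamond Y k"
      using P WD Ws by (auto intro!: drop_in_diamond drop_in_space)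
  next
    fix Q assume "Q \<in> {Q \<in> topspace (amb N k). put Q \<in> C'} \<inter> diamond Y k"
    then have Q: "Q \<in> space_hat N k" "put Q \<in> C'" "Q \<in> diamond Y k" by auto
    then have D: "put Q \<in> diamond Y (Suc k)" by (intro put_in_diamond) auto
    have "t_of (Suc k) (put Q) = Some 0" by (simp add: t_of_put)
    then have "put Q \<in> Z \<inter> face Y (Suc k) (Suc k) (Some 0)"
      using D Q(2) C(2) by (auto simp: C'_def face_def)
    then have "put Q \<in> W" using irr_component_closed[OF W] Q(2) unfolding C'_def by blast
    then show "Q \<in> dropc ` W" using drop_put[OF Q(1)] by (metis imageI)
  qed
  ultimately show "closedin (subtopology (amb N k) (diamond Y k)) (forget_t (Suc k) ` W)"
    unfolding img closedin_subtopology by blast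
qed

text \<open>A component of the face \<open>t\<^sub>n = 0\<close> contained in \<open>x = 0\<close> would meet an intersection of two faces
  in codimension one.\<close>

lemma zero_face_component_not_degenerate:
  assumes "Y \<noteq> {}" "1 \<le> p" "1 \<le> n" and Z: "Z \<in> admissible Y N m p n"
    and W: "W \<in> irr_components (amb N n) (Z \<inter> face Y n n (Some 0))"
  shows "\<exists>P\<in>W. x_of P \<noteq> 0"
proof (rule ccontr)
  assume "\<not> (\<exists>P\<in>W. x_of P \<noteq> 0)"
  then have x: "x_of P = 0" if "P \<in> W" for P using that by blast
  let ?F = "face Y n n (Some 0)" and ?D = "degenerate_face Y n"
  have closed: "closedin (subtopology (amb N n) (diamond Y n)) Z"
    and proper: "proper_on_faces Y N p n (closure_hat Y N n Z)"
    and "irreducible_in (amb N n) Z"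
    using Z \<open>1 \<le> p\<close> by (auto simp: admissible_def)
  then have Z_sub: "Z \<subseteq> topspace (amb N n)" by (simp add: irreducible_in_def)
  obtain C where C: "closedin (amb N n) C" "Z = C \<inter> diamond Y n"
    using closed by (auto simp: closedin_subtopology)
  have "Z \<subseteq> amb N n closure_of Z" using Z_sub by (rule closure_of_subset)
  moreover have "amb N n closure_of Z \<subseteq> C" using C by (intro closure_of_minimal) auto
  moreover have "diamond Y n \<subseteq> diamond_hat Y n" by (auto simp: diamond_def diamond_hat_def)
  \<comment> \<open>\<open>Z\<close> is closed in \<open>diamond Y n\<close>, so its closure adds
    nothing there; proper intersection, imposed on the closure, thus applies to \<open>Z\<close>
    itself.\<close>
  ultimately have hat: "closure_hat Y N n Z \<inter> S = Z \<inter> S" if "S \<subseteq> diamond Y n" for S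
    using that C(2) unfolding closure_hat_def by blast
  have F: "?F \<in> codim1_faces Y n" and D: "?D \<in> codim1_faces Y n"
    using \<open>1 \<le> n\<close> by (auto simp: codim1_faces_def)
  have sub: "?F \<subseteq> diamond Y n" by (auto simp: face_def)
  \<comment> \<open>A point with x = 1 on the first face shows that the two faces are different
    sets; if they coincided, the set of both would have cardinality 1.\<close>
  obtain y where "y \<in> Y" using \<open>Y \<noteq> {}\<close> by blast
  then have "(y, 1, replicate n (Some 0)) \<in> ?F" "(y, 1, replicate n (Some 0)) \<notin> ?D"
    using \<open>1 \<le> n\<close> by (auto simp: face_def degenerate_face_def diamond_def t_of_def x_of_def)
  then have "?F \<noteq> ?D" by blast
  then have card: "card {?F, ?D} = 2" by simp
  have "krull_dim (amb N n) W + enat (card {?F}) = enat p"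
    using proper F W hat[OF sub] unfolding proper_on_faces_def by (auto dest!: spec[of _ "{?F}"])
  moreover have "krull_dim (amb N n) W + enat (card {?F, ?D}) = enat p"
  proof -
    have "W \<subseteq> Z \<inter> ?F" by (rule irr_componentsD(2)[OF W])
    then have "W \<subseteq> Z \<inter> (?F \<inter> ?D)" using x sub by (auto simp: degenerate_face_def)
    then have "W \<in> irr_components (amb N n) (Z \<inter> (?F \<inter> ?D))"
      using irr_componentsD[OF W] unfolding irr_components_def by blast
    moreover have "closure_hat Y N n Z \<inter> \<Inter>{?F, ?D} = Z \<inter> (?F \<inter> ?D)" using hat[of "?F \<inter> ?D"] sub by auto
    ultimately have "W \<in> irr_components (amb N n) (closure_hat Y N n Z \<inter> \<Inter>{?F, ?D})" by (simp only:)
    then show ?thesis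
      using proper F D unfolding proper_on_faces_def by (auto simp del: Inter_insert)
  qed
  \<comment> \<open>The dimension increased by 1 and increased by 2 would both be \<open>p\<close>;
    infinite dimension is excluded because \<open>p\<close> is finite.\<close>
  ultimately show False
    by (cases "krull_dim (amb N n) W") (simp_all add: card)
qed

text \<open>Both sides are sums over the components \<open>W\<close> of the face that meet the locus
  where x is not 1: on the left only these survive the insertion, on the right
  \<open>connes_part\<close> discards the others.\<close>

lemma face_connes_part:
  assumes Y: "Y \<subseteq> proj N" "Y \<noteq> {}" and p: "1 \<le> p" and l: "1 \<le> l" "l \<le> n" and Z: "Z \<in> admissible Y N m p n"
  shows "face_map Y N (Suc n) (Suc n) (Some 0) (connes_part Y N n l (frag_of Z)) =
         connes_part Y N (n - 1) l (face_map Y N n n (Some 0) (frag_of Z))"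
proof -
  obtain k where n: "n = Suc k" using l by (cases n) auto
  have closed: "closedin (subtopology (amb N n) (diamond Y n)) Z" and irr: "irreducible_in (amb N n) Z"
    using Z by (auto simp: admissible_def)
  let ?C = "irr_components (amb N n) (Z \<inter> face Y n n (Some 0))"
  define C where "C = {W \<in> ?C. W \<inter> x_not_1 N n \<noteq> {}}"
  define mu where "mu W = int (face_mult N n n (Some 0) Z W)" for W
  have Zs: "Z \<subseteq> space_hat N n" using irr by (simp add: irreducible_in_def)
  have fin: "finite ?C" using Zs by (intro finite_irr_components_amb) auto
  have l': "l \<le> Suc n" "l \<le> Suc k" using l n by auto
  have x_forget: "x_of (forget_t n P) = x_of P" if "P \<in> Z" for P
    using that Zs forget_t_simps(2)[of n k P] by (auto simp: space_hat_def n)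
  \<comment> \<open>\<open>connes_part\<close> tests for points with x neither 0 nor 1, the open
    restriction only for x not 1. If all points of \<open>W\<close> with x not 1 had x = 0, so would
    all of \<open>W\<close>, which is contained in their closure.\<close>
  have generic: "{P \<in> W. x_of P \<noteq> 0 \<and> x_of P \<noteq> 1} \<noteq> {} \<longleftrightarrow> W \<inter> x_not_1 N n \<noteq> {}" if W: "W \<in> ?C" for W
  proof -
    note W' = irr_componentsD[OF W]
    have Ws: "W \<subseteq> space_hat N n" using W'(2) Zs by blast
    obtain P where P: "P \<in> W" "x_of P \<noteq> 0"
      using zero_face_component_not_degenerate[OF Y(2) p _ Z W] l by auto
    let ?O = "{P \<in> space_hat N n. x_of P \<noteq> to_ac 0}"
    have "W \<inter> x_not_1 N n \<subseteq> {P \<in> space_hat N n. x_of P = 0}"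
      if "{P \<in> W. x_of P \<noteq> 0 \<and> x_of P \<noteq> 1} = {}"
      using that by (auto simp: x_not_1_def)
    moreover have "W \<subseteq> amb N n closure_of (W \<inter> x_not_1 N n)" if "W \<inter> x_not_1 N n \<noteq> {}"
      using irreducible_in_Int_open_dense[OF W'(1) open_x_not_1 that] .
    moreover have "closedin (amb N n) {P \<in> space_hat N n. x_of P = 0}"
      unfolding amb_eq by (rule closedin_zariski_mform[OF mform_coords(1)])
    ultimately have "W \<inter> x_not_1 N n = {}" if "{P \<in> W. x_of P \<noteq> 0 \<and> x_of P \<noteq> 1} = {}"
      using that P closure_of_minimal by blast
    then show ?thesis using Ws by (auto simp: x_not_1_def)
  qed
  have part: "connes_part Y N k l (frag_of (forget_t n ` W)) =
      (if W \<inter> x_not_1 N n = {} then 0 else frag_of (connes_image k l (forget_t n ` W)))" if W: "W \<in> ?C" for W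
  proof -
    have WZ: "W \<subseteq> Z" using irr_componentsD(2)[OF W] by blast
    then have img: "{Q \<in> forget_t n ` W. x_of Q \<noteq> 0 \<and> x_of Q \<noteq> 1} = forget_t n ` {P \<in> W. x_of P \<noteq> 0 \<and> x_of P \<noteq> 1}"
      using x_forget by (auto simp: subset_iff)
    have eq: "{Q \<in> forget_t n ` W. x_of Q \<noteq> 0 \<and> x_of Q \<noteq> 1} = {} \<longleftrightarrow> W \<inter> x_not_1 N n = {}"
      unfolding img image_is_empty using generic[OF W] by argo
    show ?thesis
      using connes_part_frag_of[OF Y(1) l(1) l'(2) forget_zero_face_component(2,1)[OF Y(1) closed[unfolded n] W[unfolded n]]]
      unfolding n[symmetric] eq .
  qed
  have "connes_part Y N (n - 1) l (face_map Y N n n (Some 0) (frag_of Z)) =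
      (\<Sum>W\<in>?C. frag_cmul (mu W) (connes_part Y N k l (frag_of (forget_t n ` W))))"
    using fin by (simp add: n face_map_def connes_part_def frag_extend_sum frag_extend_cmul mu_def)
  also have "\<dots> = (\<Sum>W\<in>C. frag_cmul (mu W) (frag_of (connes_image k l (forget_t n ` W))))"
    by (rule sum.mono_neutral_cong_right) (use fin part in \<open>auto simp: C_def\<close>)
  also have "\<dots> = face_map Y N (Suc n) (Suc n) (Some 0) (connes_part Y N n l (frag_of Z))"
  proof (cases "{P \<in> Z. x_of P \<noteq> 0 \<and> x_of P \<noteq> 1} = {}")
    \<comment> \<open>Here \<open>connes_part\<close> is 0 by convention; the sum is empty as well,
      since by \<open>generic\<close> a component in \<open>C\<close> has a point with x neither 0
      nor 1.\<close>
    case True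
    have "W \<notin> C" for W
    proof
      assume "W \<in> C"
      then have W: "W \<in> ?C" "W \<inter> x_not_1 N n \<noteq> {}" by (auto simp: C_def)
      then have "{P \<in> W. x_of P \<noteq> 0 \<and> x_of P \<noteq> 1} \<noteq> {}" using generic by blast
      then show False using True irr_componentsD(2)[OF W(1)] by blast
    qed
    then have "C = {}" by blast
    then show ?thesis
      by (simp add: connes_part_frag_of[OF Y(1) l(1) l'(1) closed irr] True face_map_def)
  next
    case False
    note ctx = Y(1) l closed irr
    have eq: "forget_t (Suc n) ` connes_image n l W = connes_image k l (forget_t n ` W)" if "W \<in> C" for W
      using that irr_componentsD(2)[of W] Zs unfolding n C_def by (intro forget_connes_image l(1) l'(2)) blast
    have "connes_part Y N n l (frag_of Z) = frag_of (connes_image n l Z)"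
      unfolding connes_part_frag_of[OF Y(1) l(1) l'(1) closed irr] using False by (rule if_not_P)
    then have "face_map Y N (Suc n) (Suc n) (Some 0) (connes_part Y N n l (frag_of Z)) =
        (\<Sum>W\<in>connes_image n l ` C. frag_cmul (int (face_mult N (Suc n) (Suc n) (Some 0) (connes_image n l Z) W))
          (frag_of (forget_t (Suc n) ` W)))"
      by (simp add: face_map_def C_def components_connes_image[OF ctx])
    also have "\<dots> = (\<Sum>W\<in>C. frag_cmul (mu W) (frag_of (connes_image k l (forget_t n ` W))))"
      using inj_on_connes_image[OF ctx]
      by (subst sum.reindex) (auto simp: C_def mu_def face_mult_connes_image[OF ctx] eq[unfolded C_def] intro!: sum.cong)
    finally show ?thesis by simp
  qed
  finally show ?thesis by simp
qed

lemma face_connes_part_last: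
  assumes Y: "Y \<subseteq> proj N" and Z: "Z \<in> admissible Y N m p n"
  shows "face_map Y N (Suc n) (Suc n) (Some 0) (connes_part Y N n (Suc n) (frag_of Z)) = 0"
proof -
  have closed: "closedin (subtopology (amb N n) (diamond Y n)) Z" and irr: "irreducible_in (amb N n) Z"
    using Z by (auto simp: admissible_def)
  have "t_of (Suc n) (put_coord n (Suc n) inv_x P) \<noteq> Some 0" for P :: "'a pt"
    by (simp add: put_coord_def inv_x_def)
  then have "connes_image n (Suc n) Z \<inter> face Y (Suc n) (Suc n) (Some 0) = {}"
    by (auto simp: connes_image_def face_def)
  then show ?thesis
    by (simp add: connes_part_frag_of[OF Y _ _ closed irr] face_map_def irr_components_empty)
qed

theorem proposition0p1:
  fixes Y :: "(nat \<Rightarrow> 'k::field_char_0 alg_closure) set"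
    and z :: "'k pt set \<Rightarrow>\<^sub>0 int" and N m p n :: nat
  assumes "quasi_projective_variety N Y" and "m \<ge> 2" and "p \<ge> 1" and "n \<ge> 1"
    and "z \<in> reduced_cycles Y N m p n"
  shows "cycle_class Y N m (p - 1) n (last_face Y N (n + 1) (connes Y N n z)) =
         cycle_class Y N m (p - 1) n (connes Y N (n - 1) (last_face Y N n z))"
proof -
  have Y: "Y \<subseteq> proj N" "Y \<noteq> {}"
    using assms(1) by (auto simp: quasi_projective_variety_def irreducible_in_def)
  have z: "Poly_Mapping.keys z \<subseteq> admissible Y N m p n"
    using assms(5) by (simp add: reduced_cycles_def cycle_group_def)
  let ?d = "face_map Y N (Suc n) (Suc n) (Some 0)" and ?d' = "face_map Y N n n (Some 0)"
  \<comment> \<open>Both sides are additive in the cycle, which reduces the claim to one integral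
    subvariety.\<close>
  have comm: "?d (connes_part Y N n l z) = connes_part Y N (n - 1) l (?d' z)" if "l \<in> {1..n}" for l
    using z
  proof (induction z rule: frag_induction)
    case (one Z)
    with that show ?case by (intro face_connes_part[OF Y \<open>p \<ge> 1\<close>]) auto
  qed (simp_all add: face_map_def connes_part_def frag_extend_diff)
  have last: "?d (connes_part Y N n (Suc n) z) = 0"
    using z by (induction z rule: frag_induction)
      (use face_connes_part_last[OF Y(1)] in \<open>simp_all add: face_map_def connes_part_def frag_extend_diff\<close>)
  have "last_face Y N (n + 1) (connes Y N n z) =
      (\<Sum>l = 1..Suc n. frag_cmul ((- 1) ^ l) (?d (connes_part Y N n l z)))"
    by (simp add: last_face_def connes_def face_map_def frag_extend_sum frag_extend_cmul o_def del: sum.cl_ivl_Suc)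
  also have "\<dots> = (\<Sum>l = 1..n. frag_cmul ((- 1) ^ l) (connes_part Y N (n - 1) l (?d' z)))"
    using last comm by (simp add: sum.cl_ivl_Suc)
  \<comment> \<open>On n - 1 coordinates \<delta> runs over l from 1 to (n - 1) + 1, which is n
    because n \<ge> 1; after the loss of the term l = n + 1 both ranges and signs agree.\<close>
  also have "\<dots> = connes Y N (n - 1) (last_face Y N n z)"
    using \<open>n \<ge> 1\<close> by (simp add: connes_def last_face_def)
  finally show ?thesis by (rule arg_cong)
qed

end
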